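(* Let $\mathcal{H}_A,\mathcal{H}_B,\mathcal{H}_C$ be finite-dimensional Hilbert spaces, $d_A=\dim\mathcal{H}_A$, let $\sigma^{AB}$ be a density matrix on $\mathcal{H}_A\otimes\mathcal{H}_B$, let $\Phi_B^{BC}:\mathcal{B}(\mathcal{H}_B)\to\mathcal{B}(\mathcal{H}_B\otimes\mathcal{H}_C)$ be a completely positive trace preserving map, and let $\rho^{ABC}=\mathcal{I}_A\otimes\Phi_B^{BC}(\sigma^{AB})$. Suppose $\|\sigma^{AB}-\rho^{AB}\|_1\le\epsilon$ and $\epsilon\le\frac12$. Then $$I(A:C|B)_\rho\le 4\epsilon\log d_A+2H_b(2\epsilon).$$
   Context: $\mathcal{I}_A$ is the identity superoperator on $\mathcal{B}(\mathcal{H}_A)$. $\rho^X$ is the reduced density matrix of $\rho^{ABC}$ on subsystem $X$ (so $\rho^{AB}=\mathrm{tr}_C\rho^{ABC}$). $\|\cdot\|_1$ is the trace norm. $I(A:C|B)_\rho=S(AB)_\rho+S(BC)_\rho-S(B)_\rho-S(ABC)_\rho$ with $S(X)_\rho=-\mathrm{tr}(\rho^X\log\rho^X)$. $H_b(p)=-p\log p-(1-p)\log(1-p)$ is the binary entropy function (with $0\log0=0$); the same logarithm is used throughout. *)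

theory Defs
  imports "HOL-Analysis.Analysis"
begin

text \<open>
  A finite-dimensional Hilbert space with a chosen orthonormal basis indexed by a finite type
  \<open>'n\<close> is \<open>complex ^ 'n\<close>, and its operators are \<open>complex ^ 'n ^ 'n\<close>.
  The tensor product of the spaces indexed by \<open>'a\<close> and \<open>'b\<close> is indexed by
  \<open>'a \<times> 'b\<close>.
\<close>

type_synonym 'n cmat = "complex ^ 'n ^ 'n"

definition mscale :: "complex \<Rightarrow> 'n::finite cmat \<Rightarrow> 'n cmat" where
  "mscale c X = (\<chi> i j. c * X $ i $ j)"

definition dagger :: "'n::finite cmat \<Rightarrow> 'n cmat" where
  "dagger X = (\<chi> i j. cnj (X $ j $ i))"

definition unitary :: "'n::finite cmat \<Rightarrow> bool" where
  "unitary U \<longleftrightarrow> U ** dagger U = mat 1 \<and> dagger U ** U = mat 1"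

definition diag :: "('n \<Rightarrow> real) \<Rightarrow> 'n::finite cmat" where
  "diag d = (\<chi> i j. if i = j then complex_of_real (d i) else 0)"

definition cinner :: "complex ^ 'n::finite \<Rightarrow> complex ^ 'n \<Rightarrow> complex" where
  "cinner v w = (\<Sum>i\<in>UNIV. cnj (v $ i) * w $ i)"

definition psd :: "'n::finite cmat \<Rightarrow> bool" where
  "psd X \<longleftrightarrow> (\<forall>v. cinner v (X *v v) \<in> \<real>\<^sub>\<ge>\<^sub>0)"

definition density_matrix :: "'n::finite cmat \<Rightarrow> bool" where
  "density_matrix X \<longleftrightarrow> psd X \<and> trace X = 1"


subsection \<open>Functional calculus, trace norm and entropy\<close>

text \<open>
  Functional calculus for Hermitian \<open>X\<close>: diagonalise in an orthonormal eigenbasis and apply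
  \<open>f\<close> to the eigenvalues. By \<open>hfun_eq\<close> below the result does not depend on the
  diagonalisation.
\<close>

definition hfun :: "(real \<Rightarrow> real) \<Rightarrow> 'n::finite cmat \<Rightarrow> 'n cmat" where
  "hfun f X = (THE Y. \<exists>U d. unitary U \<and> X = U ** diag d ** dagger U \<and>
                              Y = U ** diag (f \<circ> d) ** dagger U)"

lemma hfun_unique:
  assumes "unitary U" "unitary V"
    and eq: "U ** diag d ** dagger U = V ** diag e ** dagger V"
  shows "U ** diag (f \<circ> d) ** dagger U = V ** diag (f \<circ> e) ** dagger V"
proof -
  define W where "W = dagger V ** U"
  have U: "U ** dagger U = mat 1" "dagger U ** U = mat 1"
    and V: "V ** dagger V = mat 1" "dagger V ** V = mat 1"
    using assms by (auto simp: unitary_def)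
  have VW: "V ** W = U"
    unfolding W_def by (simp add: matrix_mul_assoc V)
  have WU: "W ** dagger U = dagger V"
    unfolding W_def by (simp add: matrix_mul_assoc[symmetric] U)
  have right: "(W ** diag g) $ i $ j = W $ i $ j * g j" for g i j
    by (simp add: matrix_matrix_mult_def diag_def if_distrib[of "\<lambda>x. _ * x"] cong: if_cong)
  have left: "(diag g ** W) $ i $ j = g i * W $ i $ j" for g i j
    by (simp add: matrix_matrix_mult_def diag_def if_distrib[of "\<lambda>x. x * _"] cong: if_cong)
  have "W ** diag d = dagger V ** (U ** diag d ** dagger U) ** U"
    by (simp add: W_def matrix_mul_assoc[symmetric] U)
  also have "\<dots> = diag e ** W"
    unfolding eq by (simp add: W_def matrix_mul_assoc V)
  finally have *: "W ** diag d = diag e ** W" .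
  have "W ** diag (f \<circ> d) = diag (f \<circ> e) ** W"
  proof -
    have "(W ** diag (f \<circ> d)) $ i $ j = (diag (f \<circ> e) ** W) $ i $ j" for i j
    proof -
      have "W $ i $ j * d j = e i * W $ i $ j"
        using arg_cong[OF *, of "\<lambda>X. X $ i $ j"] by (simp only: left right)
      then have "W $ i $ j = 0 \<or> d j = e i"
        by (simp add: mult.commute)
      then show ?thesis
        unfolding left right by auto
    qed
    then show ?thesis by (simp add: vec_eq_iff)
  qed
  then have "(V ** W) ** diag (f \<circ> d) ** dagger U = V ** diag (f \<circ> e) ** (W ** dagger U)"
    by (metis matrix_mul_assoc)
  then show ?thesis
    by (simp only: VW WU)
qed

lemma hfun_eq:
  assumes "unitary U"
  shows "hfun f (U ** diag d ** dagger U) = U ** diag (f \<circ> d) ** dagger U"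
  unfolding hfun_def
proof (rule the_equality)
  show "\<exists>V e. unitary V \<and> U ** diag d ** dagger U = V ** diag e ** dagger V \<and>
               U ** diag (f \<circ> d) ** dagger U = V ** diag (f \<circ> e) ** dagger V"
    using assms by (intro exI[of _ U] exI[of _ d]) simp
next
  fix Y
  assume "\<exists>V e. unitary V \<and> U ** diag d ** dagger U = V ** diag e ** dagger V \<and>
                 Y = V ** diag (f \<circ> e) ** dagger V"
  then obtain V e where "unitary V" "U ** diag d ** dagger U = V ** diag e ** dagger V"
    and Y: "Y = V ** diag (f \<circ> e) ** dagger V"
    by (elim exE conjE)
  then show "Y = U ** diag (f \<circ> d) ** dagger U"
    using hfun_unique[OF assms] by simp
qed

definition trace_norm :: "'n::finite cmat \<Rightarrow> real" where
  "trace_norm X = Re (trace (hfun sqrt (dagger X ** X)))"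

text \<open>
  The logarithm has an arbitrary base \<open>k\<close>. The value of \<open>log k\<close> at \<open>0\<close>
  is irrelevant, as the eigenvalue \<open>0\<close> contributes \<open>0 * log k 0 = 0\<close>.
\<close>

definition entropy :: "real \<Rightarrow> 'n::finite cmat \<Rightarrow> real" where
  "entropy k X = - Re (trace (X ** hfun (log k) X))"

definition binary_entropy :: "real \<Rightarrow> real \<Rightarrow> real" where
  "binary_entropy k p = - p * log k p - (1 - p) * log k (1 - p)"


subsection \<open>Reduced states and conditional mutual information\<close>

definition reduce_AB :: "('a::finite \<times> 'b::finite \<times> 'c::finite) cmat \<Rightarrow> ('a \<times> 'b) cmat" where
  "reduce_AB R = (\<chi> p q. \<Sum>c\<in>UNIV. R $ (fst p, snd p, c) $ (fst q, snd q, c))"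

definition reduce_BC :: "('a::finite \<times> 'b::finite \<times> 'c::finite) cmat \<Rightarrow> ('b \<times> 'c) cmat" where
  "reduce_BC R = (\<chi> p q. \<Sum>a\<in>UNIV. R $ (a, p) $ (a, q))"

definition reduce_B :: "('a::finite \<times> 'b::finite \<times> 'c::finite) cmat \<Rightarrow> 'b cmat" where
  "reduce_B R = (\<chi> i j. \<Sum>a\<in>UNIV. \<Sum>c\<in>UNIV. R $ (a, i, c) $ (a, j, c))"

definition cond_mutual_info :: "real \<Rightarrow> ('a::finite \<times> 'b::finite \<times> 'c::finite) cmat \<Rightarrow> real" where
  "cond_mutual_info k R =
     entropy k (reduce_AB R) + entropy k (reduce_BC R) - entropy k (reduce_B R) - entropy k R"


subsection \<open>Superoperators\<close>

text \<open>
  Complete positivity: for every \<open>n\<close>, the map \<open>\<I>\<^sub>n \<otimes> \<Phi>\<close> preserves positive semidefiniteness.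
  As \<open>n\<close> has to be quantified inside the definition, an operator on the tensor product
  of the \<open>n\<close>-dimensional space with \<open>complex ^ 'm\<close> is given by its \<open>n \<times> n\<close> blocks
  \<open>X i j\<close> (with \<open>i, j < n\<close>), to each of which \<open>\<I>\<^sub>n \<otimes> \<Phi>\<close> applies \<open>\<Phi>\<close>.
\<close>

definition block_psd :: "nat \<Rightarrow> (nat \<Rightarrow> nat \<Rightarrow> 'm::finite cmat) \<Rightarrow> bool" where
  "block_psd n X \<longleftrightarrow>
     (\<forall>v :: nat \<Rightarrow> complex ^ 'm. (\<Sum>i<n. \<Sum>j<n. cinner (v i) (X i j *v v j)) \<in> \<real>\<^sub>\<ge>\<^sub>0)"

definition completely_positive :: "('m::finite cmat \<Rightarrow> 'n::finite cmat) \<Rightarrow> bool" where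
  "completely_positive \<Phi> \<longleftrightarrow> (\<forall>n X. block_psd n X \<longrightarrow> block_psd n (\<lambda>i j. \<Phi> (X i j)))"

definition cptp :: "('m::finite cmat \<Rightarrow> 'n::finite cmat) \<Rightarrow> bool" where
  "cptp \<Phi> \<longleftrightarrow> Vector_Spaces.linear mscale mscale \<Phi> \<and> completely_positive \<Phi> \<and>
     (\<forall>X. trace (\<Phi> X) = trace X)"

text \<open>
  \<open>id_tensor \<Phi>\<close> is \<open>\<I> \<otimes> \<Phi>\<close>: it applies \<open>\<Phi>\<close> to every block of \<open>S = \<Sum>a a'. |a><a'| \<otimes> S\<^sub>a\<^sub>a\<^sub>'\<close>.
\<close>

definition id_tensor ::
  "('m::finite cmat \<Rightarrow> 'n::finite cmat) \<Rightarrow> ('a::finite \<times> 'm) cmat \<Rightarrow> ('a \<times> 'n) cmat" where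
  "id_tensor \<Phi> S =
     (\<chi> p q. \<Phi> (\<chi> i j. S $ (fst p, i) $ (fst q, j)) $ snd p $ snd q)"

definition tensor :: "'a::finite cmat \<Rightarrow> 'm::finite cmat \<Rightarrow> ('a \<times> 'm) cmat" where
  "tensor X Y = (\<chi> p q. X $ fst p $ fst q * Y $ snd p $ snd q)"

lemma vector_space_mscale: "vector_space (mscale :: complex \<Rightarrow> 'n::finite cmat \<Rightarrow> 'n cmat)"
  by unfold_locales (auto simp: mscale_def vec_eq_iff algebra_simps)

lemma linear_id_tensor:
  fixes \<Phi> :: "'m::finite cmat \<Rightarrow> 'n::finite cmat"
  assumes "Vector_Spaces.linear mscale mscale \<Phi>"
  shows "Vector_Spaces.linear mscale mscale
           (id_tensor \<Phi> :: ('a::finite \<times> 'm) cmat \<Rightarrow> ('a \<times> 'n) cmat)"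
proof -
  interpret \<Phi>: Vector_Spaces.linear mscale mscale \<Phi> by (fact assms)
  have *: "(\<chi> i j. S $ (a, i) $ (a', j) + T $ (a, i) $ (a', j)) =
        (\<chi> i j. S $ (a, i) $ (a', j)) + (\<chi> i j. T $ (a, i) $ (a', j))"
    for S T :: "('a \<times> 'm) cmat" and a a'
    by (simp add: vec_eq_iff)
  have add: "id_tensor \<Phi> (S + T) = id_tensor \<Phi> S + id_tensor \<Phi> T" for S T :: "('a \<times> 'm) cmat"
    unfolding id_tensor_def vector_add_component * \<Phi>.add by (simp add: vec_eq_iff)
  have *: "(\<chi> i j. mscale c S $ (a, i) $ (a', j)) = mscale c (\<chi> i j. S $ (a, i) $ (a', j))"
    for c and S :: "('a \<times> 'm) cmat" and a a'
    by (simp add: vec_eq_iff mscale_def)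
  have scale: "id_tensor \<Phi> (mscale c S) = mscale c (id_tensor \<Phi> S)" for c and S :: "('a \<times> 'm) cmat"
    unfolding id_tensor_def * \<Phi>.scale by (simp add: vec_eq_iff mscale_def)
  show ?thesis
    unfolding Vector_Spaces.linear_def module_hom_def module_hom_axioms_def module_iff_vector_space
    using add scale by (blast intro: vector_space_mscale)
qed

lemma id_tensor_tensor:
  assumes "Vector_Spaces.linear mscale mscale \<Phi>"
  shows "id_tensor \<Phi> (tensor X Y) = tensor X (\<Phi> Y)"
proof -
  interpret \<Phi>: Vector_Spaces.linear mscale mscale \<Phi> by (fact assms)
  have "(\<chi> i j. tensor X Y $ (a, i) $ (a', j)) = mscale (X $ a $ a') Y" for a a'
    by (simp add: vec_eq_iff mscale_def tensor_def)
  then show ?thesis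
    by (simp add: id_tensor_def vec_eq_iff \<Phi>.scale) (simp add: mscale_def tensor_def)
qed

end

theory Submission imports Defs begin

text \<open>
  Write \<open>H(X) = S(X\<^sub>B) - S(X) = D(X \<parallel> I \<otimes> X\<^sub>B)\<close> for a positive operator \<open>X\<close> on \<open>A \<otimes> B\<close>, so that
  \<open>I(A:C|B)\<^sub>\<rho> = H(\<rho>\<^sup>A\<^sup>B\<^sup>C) - H(\<rho>\<^sup>A\<^sup>B)\<close>. Since \<open>\<I> \<otimes> \<Phi>\<close> maps \<open>I \<otimes> \<sigma>\<^sup>B\<close> to \<open>I \<otimes> \<rho>\<^sup>B\<^sup>C\<close>, the
  monotonicity of relative entropy gives \<open>H(\<rho>\<^sup>A\<^sup>B\<^sup>C) \<le> H(\<sigma>\<^sup>A\<^sup>B)\<close>, and it remains to bound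
  \<open>H(\<sigma>) - H(\<tau>)\<close> for \<open>\<tau> = \<rho>\<^sup>A\<^sup>B\<close> (the continuity bound of Alicki, Fannes and Winter). With
  \<open>\<sigma> - \<tau> = N - M\<close> the Jordan decomposition, \<open>\<sigma> + M = \<tau> + N\<close>; now \<open>H\<close> is subadditive on
  the right-hand side, superadditive up to a binary entropy term on the left-hand side, and
  \<open>\<bar>H(X)\<bar> \<le> tr X ln d\<^sub>A\<close>.

  All properties of \<open>D(R \<parallel> S)\<close> come from one comparison principle. In eigenbases of \<open>R\<close> and \<open>S\<close>,
  \<open>D(R \<parallel> S) = \<Sum> w\<^sub>i\<^sub>j p\<^sub>j (ln p\<^sub>j - ln q\<^sub>i)\<close>, which is the limit for \<open>t \<rightarrow> \<infinity>\<close> of \<open>G(t) - tr R ln t\<close>, where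
  \<open>G(0) = 0\<close> and \<open>G'(t) = \<Sum> w\<^sub>i\<^sub>j p\<^sub>j\<^sup>2 / (q\<^sub>i + t p\<^sub>j)\<close>. The derivative has the variational form
  \<open>sup\<^sub>X 2 Re tr(X\<^sup>* R) - tr(X\<^sup>* S X) - t tr(X R X\<^sup>*)\<close>, from which joint convexity and antitonicity
  in \<open>S\<close> are immediate, and monotonicity under a channel follows by inserting its adjoint
  applied to \<open>X\<close> and using the Schwarz inequality.
\<close>

subsection \<open>Matrices and sesquilinear forms\<close>

lemma dagger_nth [simp]: "dagger X $ i $ j = cnj (X $ j $ i)"
  by (simp add: dagger_def)

lemma dagger_dagger [simp]: "dagger (dagger X) = X"
  by (simp add: vec_eq_iff)

lemma dagger_mult: "dagger (X ** Y) = dagger Y ** dagger X"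
  by (simp add: vec_eq_iff matrix_matrix_mult_def mult.commute)

lemma matrix_add_rdistrib: "(X + Y) ** Z = X ** Z + Y ** Z" for X Y Z :: "'n::finite cmat"
  by (simp add: vec_eq_iff matrix_matrix_mult_def algebra_simps sum.distrib)

lemma matrix_diff_rdistrib: "(X - Y) ** Z = X ** Z - Y ** Z" for X Y Z :: "'n::finite cmat"
  by (simp add: vec_eq_iff matrix_matrix_mult_def algebra_simps sum_subtractf)

lemma matrix_diff_ldistrib: "Z ** (X - Y) = Z ** X - Z ** Y" for X Y Z :: "'n::finite cmat"
  by (simp add: vec_eq_iff matrix_matrix_mult_def algebra_simps sum_subtractf)

lemma trace_dagger: "trace (dagger X) = cnj (trace X)"
  by (simp add: trace_def)

lemma diag_mult_left: "(diag d ** X) $ i $ j = d i * X $ i $ j"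
  by (simp add: matrix_matrix_mult_def diag_def if_distrib[of "\<lambda>x. x * _"] cong: if_cong)

lemma diag_mult_right: "(X ** diag d) $ i $ j = X $ i $ j * d j"
  by (simp add: matrix_matrix_mult_def diag_def if_distrib[of "\<lambda>x. _ * x"] cong: if_cong)

lemma diag_mult_diag: "diag d ** diag e = diag (\<lambda>i. d i * e i)"
  by (simp add: vec_eq_iff diag_mult_left) (simp add: diag_def)

lemma trace_cyclic: "trace (X ** Y) = trace (Y ** X)" for X :: "'n::finite cmat"
  by (rule trace_mul_sym)

lemma unitaryD: "unitary U \<Longrightarrow> dagger U ** U = mat 1" "unitary U \<Longrightarrow> U ** dagger U = mat 1"
  by (auto simp: unitary_def)

lemma unitary_cancel:
  assumes "unitary U"
  shows "dagger U ** (U ** X) = X" "U ** (dagger U ** X) = X"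
  using assms by (simp_all add: matrix_mul_assoc unitary_def)

lemma trace_conj_diag:
  assumes "unitary U"
  shows "trace (U ** diag d ** dagger U) = of_real (sum d UNIV)"
proof -
  have "trace (U ** diag d ** dagger U) = trace (diag d)"
    using assms by (subst trace_cyclic) (simp add: matrix_mul_assoc unitary_def)
  then show ?thesis by (simp add: trace_def diag_def)
qed

lemma conj_diag_mult:
  assumes "unitary U"
  shows "(U ** diag d ** dagger U) ** (U ** diag e ** dagger U) = U ** diag (\<lambda>i. d i * e i) ** dagger U"
  by (simp add: matrix_mul_assoc[symmetric] unitary_cancel[OF assms] flip: diag_mult_diag)

lemma cinner_add_left: "cinner (u + v) w = cinner u w + cinner v w"
  and cinner_add_right: "cinner w (u + v) = cinner w u + cinner w v"
  and cinner_diff_left: "cinner (u - v) w = cinner u w - cinner v w"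
  and cinner_diff_right: "cinner w (u - v) = cinner w u - cinner w v"
  and cinner_scale_left: "cinner (c *s v) w = cnj c * cinner v w"
  and cinner_scale_right: "cinner v (c *s w) = c * cinner v w"
  and cinner_zero [simp]: "cinner 0 w = 0" "cinner w 0 = 0"
  by (simp_all add: cinner_def algebra_simps sum.distrib sum_subtractf sum_distrib_left)

lemma cinner_commute: "cinner v w = cnj (cinner w v)"
  by (simp add: cinner_def mult.commute)

lemma cinner_self: "cinner v v = of_real ((norm v)\<^sup>2)"
  by (simp add: cinner_def norm_vec_def L2_set_def sum_nonneg mult.commute flip: complex_norm_square)

lemma cinner_adjoint: "cinner v (X *v w) = cinner (dagger X *v v) w"
proof -
  have "cinner v (X *v w) = (\<Sum>i\<in>UNIV. \<Sum>j\<in>UNIV. cnj (v $ i) * X $ i $ j * w $ j)"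
    by (simp add: cinner_def matrix_vector_mult_def sum_distrib_left mult.assoc)
  also have "\<dots> = (\<Sum>j\<in>UNIV. \<Sum>i\<in>UNIV. cnj (v $ i) * X $ i $ j * w $ j)"
    by (rule sum.swap)
  also have "\<dots> = cinner (dagger X *v v) w"
    by (simp add: cinner_def matrix_vector_mult_def sum_distrib_left mult_ac)
  finally show ?thesis .
qed

lemma cinner_mult_expand:
  "cinner v (X *v w) = (\<Sum>i\<in>UNIV. \<Sum>j\<in>UNIV. cnj (v $ i) * X $ i $ j * w $ j)"
  by (simp add: cinner_def matrix_vector_mult_def sum_distrib_left mult.assoc)

lemma cinner_axis: "cinner (axis i 1) (X *v axis j 1) = X $ i $ j"
proof -
  have "cinner (axis i 1) w = w $ i" for w :: "complex^'a"
    by (simp add: cinner_def axis_def if_distrib[of cnj] if_distrib[of "\<lambda>x. x * _"] cong: if_cong)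
  then show ?thesis
    by (simp add: matrix_vector_mult_def axis_def if_distrib[of "\<lambda>x. _ * x"] cong: if_cong)
qed

lemma psd_iff: "psd X \<longleftrightarrow> (\<forall>v. 0 \<le> Re (cinner v (X *v v)) \<and> Im (cinner v (X *v v)) = 0)"
  by (simp add: psd_def complex_nonneg_Reals_iff)

lemma matrix_vector_scale: "X *v (c *s v) = c *s (X *v v)" for X :: "'n::finite cmat"
  by (simp add: vec_eq_iff matrix_vector_mult_def sum_distrib_left mult_ac)

text \<open>Polarization: reality of the form at \<open>v + w\<close> matches the imaginary parts of
  the two mixed terms up to sign, and at \<open>v + \<i> *s w\<close> their real parts.\<close>

lemma hermitian_if_real_form:
  assumes "\<And>v. Im (cinner v (X *v v)) = 0"
  shows "dagger X = X"
proof -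
  have "cinner v (X *v w) = cnj (cinner w (X *v v))" for v w
  proof -
    have "Im (cinner v (X *v w) + cinner w (X *v v)) = 0"
      using assms[of "v + w"] assms[of v] assms[of w]
      by (simp add: cinner_add_left cinner_add_right matrix_vector_right_distrib)
    moreover have "Im (\<i> * cinner v (X *v w) - \<i> * cinner w (X *v v)) = 0"
      using assms[of "v + \<i> *s w"] assms[of v] assms[of w]
      by (simp add: cinner_add_left cinner_add_right matrix_vector_right_distrib
          cinner_scale_left cinner_scale_right matrix_vector_scale)
    ultimately show ?thesis by (simp add: complex_eq_iff)
  qed
  from this[of "axis i 1" "axis j 1" for i j] have "cnj (X $ j $ i) = X $ i $ j" for i j
    unfolding cinner_axis by (rule sym)
  then show ?thesis
    by (simp only: vec_eq_iff dagger_nth) blast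
qed

lemma psd_hermitian: "psd X \<Longrightarrow> dagger X = X"
  by (rule hermitian_if_real_form) (simp add: psd_iff)

subsection \<open>The spectral theorem\<close>

text \<open>The conjugates of the \<open>u i\<close> with \<open>i\<close> in \<open>S\<close> are
  rows of a square matrix whose row \<open>i0\<close> is zero. It is singular, and a nonzero kernel
  vector is orthogonal to all of them.\<close>

lemma exists_orthogonal_vector:
  fixes u :: "'n::finite \<Rightarrow> complex ^ 'n"
  assumes "i0 \<notin> S"
  shows "\<exists>w. w \<noteq> 0 \<and> (\<forall>i\<in>S. cinner (u i) w = 0)"
proof -
  define M :: "'n cmat" where "M = (\<chi> r c. if r \<in> S then cnj (u r $ c) else 0)"
  have "row i0 M = 0"
    using assms by (simp add: M_def row_def vec_eq_iff)
  then have "\<not> invertible M"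
    by (metis det_zero_row(2) invertible_det_nz row_def)
  then obtain w where w: "M *v w = 0" "w \<noteq> 0"
    using invertible_left_inverse matrix_left_invertible_ker by blast
  have "cinner (u i) w = (M *v w) $ i" if "i \<in> S" for i
    using that by (simp add: M_def cinner_def matrix_vector_mult_def)
  with w show ?thesis by auto
qed

text \<open>Rayleigh's principle on an invariant subspace. For a maximiser \<open>v\<close> of the
  quadratic form of \<open>A\<close> on the unit sphere of \<open>W\<close>, the operator
  \<open>B\<close>, that is \<open>f v\<close> times the identity minus \<open>A\<close>, has
  nonnegative form on \<open>W\<close> and form 0 at \<open>v\<close>; perturbing \<open>v\<close>
  in the direction \<open>B v\<close> forces \<open>B v = 0\<close>.\<close>

lemma hermitian_max_eigenvector:
  fixes A :: "'n::finite cmat"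
  assumes A: "dagger A = A"
    and W_add: "\<And>v w. v \<in> W \<Longrightarrow> w \<in> W \<Longrightarrow> v + w \<in> W"
    and W_scale: "\<And>c v. v \<in> W \<Longrightarrow> c *s v \<in> W"
    and W_A: "\<And>v. v \<in> W \<Longrightarrow> A *v v \<in> W"
    and "closed W" "w0 \<in> W" "w0 \<noteq> 0"
  shows "\<exists>v (d::real). v \<in> W \<and> norm v = 1 \<and> A *v v = complex_of_real d *s v"
proof -
  define f where "f v = Re (cinner v (A *v v))" for v
  have norm_scale: "norm (complex_of_real c *s v) = \<bar>c\<bar> * norm v" for c and v :: "complex^'n"
  proof -
    have "complex_of_real c *s v = c *\<^sub>R v"
      by (simp only: vec_eq_iff vector_smult_component vector_scaleR_component) (simp add: scaleR_conv_of_real)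
    then show ?thesis by simp
  qed
  have normalize: "norm (complex_of_real (1 / norm w) *s w) = 1" if "w \<noteq> 0" for w :: "complex^'n"
    unfolding norm_scale using that by simp
  have "continuous_on (sphere 0 1 \<inter> W) f"
    unfolding f_def cinner_def matrix_vector_mult_def by (intro continuous_intros)
  moreover have "compact (sphere 0 1 \<inter> W)"
    using \<open>closed W\<close> by (intro compact_Int_closed compact_sphere)
  moreover have "complex_of_real (1 / norm w0) *s w0 \<in> sphere 0 1 \<inter> W"
    using assms normalize by (simp del: of_real_divide)
  moreover from calculation(3) have "sphere 0 1 \<inter> W \<noteq> {}"
    by blast
  ultimately obtain v where "v \<in> sphere 0 1 \<inter> W"
    and max': "\<forall>w\<in>sphere 0 1 \<inter> W. f w \<le> f v"
    using continuous_attains_sup[of "sphere 0 1 \<inter> W" f] by blast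
  then have v: "v \<in> W" "norm v = 1" and max: "\<And>w. w \<in> sphere 0 1 \<inter> W \<Longrightarrow> f w \<le> f v"
    by auto
  have bound: "f w \<le> f v * (norm w)\<^sup>2" if "w \<in> W" for w
  proof (cases "w = 0")
    case False
    have "f (complex_of_real (1 / norm w) *s w) \<le> f v"
      using that False by (intro max) (simp add: normalize W_scale del: of_real_divide)
    then show ?thesis
      using False by (simp add: f_def matrix_vector_scale cinner_scale_left cinner_scale_right
          field_simps power2_eq_square)
  qed (simp add: f_def)
  define B where "B w = complex_of_real (f v) *s w - A *v w" for w
  have B_form: "Re (cinner w (B w)) \<ge> 0" if "w \<in> W" for w
    using bound[OF that] by (simp add: B_def cinner_diff_right cinner_scale_right cinner_self f_def)
  define w where "w = B v"
  have neg: "- x = (-1) *s x" for x :: "complex^'n" by (simp add: vec_eq_iff)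
  have "w \<in> W"
    unfolding w_def B_def diff_conv_add_uminus neg
    by (intro W_add W_scale W_A v)
  have vB: "Re (cinner v (B v)) = 0"
    using v by (simp add: B_def cinner_diff_right cinner_scale_right cinner_self f_def)
  have vw: "cinner v (B w) = of_real ((norm w)\<^sup>2)"
  proof -
    have "cinner v (B w) = cinner (B v) w"
      by (simp add: B_def cinner_diff_right cinner_diff_left cinner_scale_right cinner_scale_left
          cinner_adjoint[of v] A)
    then show ?thesis
      using cinner_self[of w] by (simp add: w_def)
  qed
  \<comment> \<open>The form of \<open>B\<close> along the line \<open>v + s w\<close> has no
    constant term, and its linear coefficient is twice the squared norm of \<open>w\<close>.\<close>
  have "0 \<le> 2 * s * (norm w)\<^sup>2 + s\<^sup>2 * Re (cinner w (B w))" for s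
  proof -
    have "B (v + of_real s *s w) = B v + of_real s *s B w"
      by (simp add: B_def matrix_vector_right_distrib matrix_vector_scale vec_eq_iff algebra_simps)
    then have "Re (cinner (v + of_real s *s w) (B (v + of_real s *s w))) =
        2 * s * (norm w)\<^sup>2 + s\<^sup>2 * Re (cinner w (B w))"
      using vB vw cinner_self[of w]
      by (simp add: cinner_add_left cinner_add_right cinner_scale_left cinner_scale_right
          power2_eq_square algebra_simps flip: w_def)
    then show ?thesis
      using B_form[OF W_add[OF v(1) W_scale[OF \<open>w \<in> W\<close>]], of "of_real s"] by simp
  qed
  note quad = this
  have "norm w = 0"
  proof (rule ccontr)
    assume "norm w \<noteq> 0"
    define a b where "a = (norm w)\<^sup>2" and "b = Re (cinner w (B w))"
    have "a > 0" "b \<ge> 0"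
      using \<open>norm w \<noteq> 0\<close> B_form[OF \<open>w \<in> W\<close>] by (auto simp: a_def b_def)
    \<comment> \<open>A negative \<open>s\<close> this small lets the linear term win over the
      quadratic one; the \<open>+ 1\<close> keeps the denominator positive when
      \<open>b = 0\<close>.\<close>
    have "0 \<le> 2 * (- a / (b + 1)) * a + (- a / (b + 1))\<^sup>2 * b"
      using quad[of "- a / (b + 1)"] by (simp only: a_def b_def)
    also have "\<dots> = a * a * (b / (b + 1) - 2) / (b + 1)"
    proof -
      have "b + 1 \<noteq> 0"
        using \<open>b \<ge> 0\<close> by simp
      then show ?thesis
        by (simp add: divide_simps power2_eq_square) (simp add: algebra_simps)
    qed
    finally have "0 \<le> a * a * (b / (b + 1) - 2) / (b + 1)" .
    moreover have "b / (b + 1) - 2 < 0"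
      using \<open>b \<ge> 0\<close> by (simp add: field_simps)
    ultimately show False
      using mult_pos_pos[OF \<open>a > 0\<close> \<open>a > 0\<close>] \<open>b \<ge> 0\<close>
      by (simp add: zero_le_divide_iff zero_le_mult_iff)
  qed
  then have "A *v v = complex_of_real (f v) *s v"
    by (simp add: w_def B_def)
  with v show ?thesis by blast
qed

text \<open>Induction on \<open>S\<close>: as \<open>A\<close> is Hermitian, the orthogonal
  complement of the eigenvectors found so far is invariant under \<open>A\<close>. It is nonzero
  while an index remains, so maximising the form there supplies the next eigenvector.\<close>

lemma hermitian_eigenvectors:
  fixes A :: "'n::finite cmat" and S :: "'n set"
  assumes A: "dagger A = A"
  shows "\<exists>u (d :: 'n \<Rightarrow> real). \<forall>i\<in>S. A *v u i = complex_of_real (d i) *s u i \<and>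
           (\<forall>j\<in>S. cinner (u i) (u j) = (if i = j then 1 else 0))"
  using finite[of S]
proof (induction S rule: finite_induct)
  case (insert i0 S)
  then obtain u d where ud: "\<And>i. i \<in> S \<Longrightarrow> A *v u i = complex_of_real (d i) *s u i"
    and orth: "\<And>i j. i \<in> S \<Longrightarrow> j \<in> S \<Longrightarrow> cinner (u i) (u j) = (if i = j then 1 else 0)"
    by blast
  define W where "W = (\<Inter>i\<in>S. {w. cinner (u i) w = 0})"
  obtain w0 where "w0 \<noteq> 0" "w0 \<in> W"
    using exists_orthogonal_vector[OF \<open>i0 \<notin> S\<close>, of u] by (auto simp: W_def)
  moreover have "closed W"
    unfolding W_def cinner_def by (intro closed_INT ballI closed_Collect_eq continuous_intros)
  moreover have "A *v w \<in> W" if "w \<in> W" for w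
    using that ud by (auto simp: W_def cinner_adjoint A cinner_scale_left)
  ultimately obtain v e where v: "v \<in> W" "norm v = 1" "A *v v = complex_of_real e *s v"
    using hermitian_max_eigenvector[OF A, of W w0]
    by (auto simp: W_def cinner_add_right cinner_scale_right)
  have 1: "cinner (u i) v = 0" "cinner v (u i) = 0" if "i \<in> S" for i
    using v that cinner_commute[of v "u i"] by (auto simp: W_def)
  show ?case
  proof (intro exI[of _ "u(i0 := v)"] exI[of _ "d(i0 := e)"])
    show "\<forall>i\<in>insert i0 S. A *v (u(i0 := v)) i = complex_of_real ((d(i0 := e)) i) *s (u(i0 := v)) i \<and>
      (\<forall>j\<in>insert i0 S. cinner ((u(i0 := v)) i) ((u(i0 := v)) j) = (if i = j then 1 else 0))"
      using insert.hyps ud orth v 1 cinner_self[of v] by auto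
  qed
qed simp

theorem spectral:
  fixes A :: "'n::finite cmat"
  assumes "dagger A = A"
  obtains U d where "unitary U" "A = U ** diag d ** dagger U"
proof -
  obtain u :: "'n \<Rightarrow> complex ^ 'n" and d :: "'n \<Rightarrow> real"
    where ud: "\<And>i. A *v u i = complex_of_real (d i) *s u i"
    and orth: "\<And>i j. cinner (u i) (u j) = (if i = j then 1 else 0)"
    using hermitian_eigenvectors[OF assms, of UNIV] by auto
  define U :: "'n cmat" where "U = (\<chi> r c. u c $ r)"
  have "dagger U ** U = mat 1"
    using orth by (simp add: vec_eq_iff U_def matrix_matrix_mult_def mat_def cinner_def)
  then have U: "unitary U"
    using matrix_left_right_inverse by (auto simp: unitary_def)
  have "A ** U = U ** diag d"
    using ud by (simp add: vec_eq_iff diag_mult_right)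
      (simp add: U_def matrix_matrix_mult_def matrix_vector_mult_def mult.commute)
  then have "A ** U ** dagger U = U ** diag d ** dagger U"
    by simp
  then have "A = U ** diag d ** dagger U"
    by (simp add: matrix_mul_assoc[symmetric] unitaryD[OF U])
  with U show thesis using that by blast
qed

lemma cinner_conj_diag:
  "cinner v (U ** diag d ** dagger U *v v) = of_real (\<Sum>i\<in>UNIV. d i * (cmod ((dagger U *v v) $ i))\<^sup>2)"
proof -
  have "cinner v (U ** diag d ** dagger U *v v) = cinner (dagger U *v v) (diag d *v (dagger U *v v))"
    by (simp add: matrix_vector_mul_assoc[symmetric] cinner_adjoint)
  also have "\<dots> = (\<Sum>i\<in>UNIV. of_real (d i) * of_real ((cmod ((dagger U *v v) $ i))\<^sup>2))"
    unfolding cinner_def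
    by (intro sum.cong refl, subst complex_norm_square)
      (simp add: matrix_vector_mult_def diag_def if_distrib[of "\<lambda>x. x * _"] mult_ac cong: if_cong)
  finally show ?thesis by simp
qed

lemma psd_conj_diag: "(\<And>i. d i \<ge> 0) \<Longrightarrow> psd (U ** diag d ** dagger U)"
  by (simp add: psd_iff cinner_conj_diag sum_nonneg)

lemma cinner_eigenvector:
  assumes "unitary U"
  shows "cinner (U *v axis i 1) (U ** diag d ** dagger U *v (U *v axis i 1)) = of_real (d i)"
proof -
  have "dagger U *v (U *v axis i 1) = axis i 1"
    using assms by (simp add: matrix_vector_mul_assoc unitaryD)
  then show ?thesis
    unfolding cinner_conj_diag
    by (simp add: axis_def if_distrib[of cmod] if_distrib[of "\<lambda>x. x^2"] if_distrib[of "\<lambda>x. _ * x"] cong: if_cong)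
qed

lemma psd_spectral:
  assumes "psd A"
  obtains U d where "unitary U" "\<And>i. d i \<ge> 0" "A = U ** diag d ** dagger U"
proof -
  obtain U d where U: "unitary U" and A: "A = U ** diag d ** dagger U"
    using spectral psd_hermitian[OF assms] by blast
  have "d i \<ge> 0" for i
    using assms[unfolded psd_iff, rule_format, of "U *v axis i 1"]
    unfolding A cinner_eigenvector[OF U] by simp
  with U A show thesis using that by blast
qed

subsection \<open>Relative entropy\<close>

text \<open>Umegaki's relative entropy, without normalisation. Under \<open>ker_le S R\<close> the
  value of \<open>ln 0\<close> does not enter the second trace, because eigenvectors of
  \<open>S\<close> with eigenvalue 0 then carry no weight of \<open>R\<close>.\<close>

definition rel_entropy :: "'n::finite cmat \<Rightarrow> 'n cmat \<Rightarrow> real" where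
  "rel_entropy R S = Re (trace (R ** hfun ln R)) - Re (trace (R ** hfun ln S))"

text \<open>For positive operators a vanishing form at \<open>v\<close> puts \<open>v\<close> into
  the kernel, so this is the kernel inclusion that makes the relative entropy finite. Stated through
  forms, it passes directly to sums and positive multiples.\<close>

definition ker_le :: "'n::finite cmat \<Rightarrow> 'n cmat \<Rightarrow> bool" where
  "ker_le S R \<longleftrightarrow> (\<forall>v. cinner v (S *v v) = 0 \<longrightarrow> cinner v (R *v v) = 0)"

text \<open>
  For \<open>t > 0\<close> and invertible \<open>S\<close> the supremum over \<open>X\<close> of this functional is
  \<open>\<langle>R, (L\<^sub>S + t R\<^sub>R)\<^sup>-\<^sup>1 R\<rangle>\<close>, where \<open>L\<^sub>S\<close> and \<open>R\<^sub>R\<close> are left and right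
  multiplication by \<open>S\<close> and \<open>R\<close>.
\<close>

definition rel_functional :: "real \<Rightarrow> 'n::finite cmat \<Rightarrow> 'n cmat \<Rightarrow> 'n cmat \<Rightarrow> real" where
  "rel_functional t R S X = 2 * Re (trace (dagger X ** R)) - Re (trace (dagger X ** S ** X)) -
     t * Re (trace (X ** R ** dagger X))"

section \<open>Traces expanded in two eigenbases\<close>

lemma trace_conj_diag_mult:
  "trace ((V ** diag p ** dagger V) ** (U ** diag e ** dagger U)) =
     of_real (\<Sum>i\<in>UNIV. \<Sum>j\<in>UNIV. (cmod ((dagger U ** V) $ i $ j))\<^sup>2 * p j * e i)"
proof -
  define W where "W = dagger U ** V"
  have "trace ((V ** diag p ** dagger V) ** (U ** diag e ** dagger U)) =
      trace (dagger U ** (V ** diag p ** dagger V ** U ** diag e))"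
    by (subst trace_cyclic) (simp add: matrix_mul_assoc)
  also have "dagger U ** (V ** diag p ** dagger V ** U ** diag e) = (W ** diag p ** dagger W) ** diag e"
    by (simp add: W_def dagger_mult matrix_mul_assoc)
  also have "trace \<dots> = (\<Sum>i\<in>UNIV. (\<Sum>j\<in>UNIV. (W $ i $ j * p j) * cnj (W $ i $ j)) * e i)"
    unfolding trace_def diag_mult_right by (simp add: matrix_matrix_mult_def[of "W ** diag p"] diag_mult_right)
  also have "\<dots> = of_real (\<Sum>i\<in>UNIV. \<Sum>j\<in>UNIV. (cmod (W $ i $ j))\<^sup>2 * p j * e i)"
    by (simp add: sum_distrib_left sum_distrib_right mult_ac complex_norm_square del: of_real_power)
  finally show ?thesis by (simp add: W_def)
qed

lemma trace_conj_diag':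
  "trace (Z ** diag p ** dagger Z) = of_real (\<Sum>i\<in>UNIV. \<Sum>j\<in>UNIV. (cmod (Z $ i $ j))\<^sup>2 * p j)"
proof -
  have "trace (Z ** diag p ** dagger Z) = (\<Sum>i\<in>UNIV. \<Sum>j\<in>UNIV. (Z $ i $ j * p j) * cnj (Z $ i $ j))"
    unfolding trace_def by (simp add: matrix_matrix_mult_def[of "Z ** diag p"] diag_mult_right)
  also have "\<dots> = of_real (\<Sum>i\<in>UNIV. \<Sum>j\<in>UNIV. (cmod (Z $ i $ j))\<^sup>2 * p j)"
    by (simp add: mult_ac complex_norm_square del: of_real_power)
  finally show ?thesis .
qed

lemma unitary_columns:
  assumes "unitary W"
  shows "(\<Sum>i\<in>UNIV. (cmod (W $ i $ j))\<^sup>2) = 1"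
proof -
  have "complex_of_real (\<Sum>i\<in>UNIV. (cmod (W $ i $ j))\<^sup>2) = (dagger W ** W) $ j $ j"
    by (simp add: matrix_matrix_mult_def complex_norm_square mult.commute del: of_real_power)
  also have "\<dots> = 1"
    using assms by (simp add: unitary_def mat_def)
  finally show ?thesis by (simp only: of_real_eq_1_iff)
qed

lemma unitary_dagger: "unitary U \<Longrightarrow> unitary (dagger U)"
  by (simp add: unitary_def)

lemma unitary_mult: "unitary U \<Longrightarrow> unitary V \<Longrightarrow> unitary (U ** V)"
  by (simp add: unitary_def dagger_mult matrix_mul_assoc[symmetric])
     (simp add: matrix_mul_assoc)

text \<open>Completing the square: with \<open>c = q + t * p > 0\<close> the gap is at least
  \<open>(cmod z * c - cmod w * p)^2 / c\<close>, and the maximum is at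
  \<open>z = w * (p / c)\<close>. The remaining case is \<open>p = 0\<close>.\<close>

lemma scalar_functional:
  fixes z w :: complex and p q t :: real
  assumes "t > 0" "p \<ge> 0" "q \<ge> 0"
  shows "2 * Re (cnj z * w) * p - (cmod z)\<^sup>2 * (q + t * p) \<le> (cmod w)\<^sup>2 * p * (p / (q + t * p))"
    and "z = w * of_real (p / (q + t * p)) \<Longrightarrow>
      2 * Re (cnj z * w) * p - (cmod z)\<^sup>2 * (q + t * p) = (cmod w)\<^sup>2 * p * (p / (q + t * p))"
proof -
  consider "p = 0" | "q + t * p > 0"
    using assms by (metis add_nonneg_pos less_eq_real_def mult_pos_pos)
  note c = this
  show "2 * Re (cnj z * w) * p - (cmod z)\<^sup>2 * (q + t * p) \<le> (cmod w)\<^sup>2 * p * (p / (q + t * p))"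
    using c
  proof cases
    case 2
    define c where "c = q + t * p"
    have "c > 0" using 2 by (simp add: c_def)
    have "Re (cnj z * w) \<le> cmod z * cmod w"
      using complex_Re_le_cmod[of "cnj z * w"] by (simp add: norm_mult)
    then have "2 * Re (cnj z * w) * p \<le> 2 * (cmod z * cmod w) * p"
      using \<open>p \<ge> 0\<close> by (simp add: mult_right_mono)
    moreover have "0 \<le> (cmod z * c - cmod w * p)\<^sup>2 / c"
      using \<open>c > 0\<close> by simp
    moreover have "(cmod z * c - cmod w * p)\<^sup>2 / c =
        (cmod z)\<^sup>2 * c - 2 * (cmod z * cmod w) * p + (cmod w)\<^sup>2 * p * (p / c)"
      using \<open>c > 0\<close> by (simp add: field_simps power2_eq_square)
    ultimately show ?thesis
      by (simp add: c_def)
  qed (use assms in simp)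
  show "2 * Re (cnj z * w) * p - (cmod z)\<^sup>2 * (q + t * p) = (cmod w)\<^sup>2 * p * (p / (q + t * p))"
    if z: "z = w * of_real (p / (q + t * p))"
    using c
  proof cases
    case 2
    define c where "c = q + t * p"
    have "c > 0" using 2 by (simp add: c_def)
    have "cnj z * w = of_real (p / c) * (w * cnj w)"
      by (simp add: z c_def[symmetric] del: of_real_add of_real_mult)
    also have "\<dots> = of_real ((cmod w)\<^sup>2 * (p / c))"
      unfolding complex_norm_square[symmetric] by simp
    finally have "Re (cnj z * w) = (cmod w)\<^sup>2 * (p / c)"
      by (simp only: Re_complex_of_real)
    moreover have "(cmod z)\<^sup>2 = (cmod w)\<^sup>2 * (p / c)\<^sup>2"
      by (simp add: z c_def[symmetric] norm_mult power_mult_distrib norm_divide power_divide)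
    moreover have "2 * (b * (p / c)) * p - b * (p / c)\<^sup>2 * c = b * p * (p / c)" for b
      using \<open>c > 0\<close> by (simp add: field_simps power2_eq_square)
    ultimately show ?thesis
      unfolding c_def[symmetric] by (simp only:)
  qed (use z in simp)
qed

text \<open>The index runs over pairs of an eigenvector of \<open>S\<close> and one of
  \<open>R\<close>, and \<open>w\<close> is their squared overlap. The weights
  \<open>w k * p k\<close> and \<open>w k * q k\<close> are the Nussbaum-Szkola pair, whose
  classical relative entropy is that of \<open>R\<close> and \<open>S\<close>. In these bases the
  entries of \<open>X\<close> decouple, so the functional can be maximised entry by entry.\<close>

lemma rel_entropy_decomposition:
  fixes R S :: "'n::finite cmat"
  assumes "psd R" "psd S" "ker_le S R"
  obtains w p q :: "'n \<times> 'n \<Rightarrow> real"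
  where "\<And>k. w k \<ge> 0" "\<And>k. p k \<ge> 0" "\<And>k. q k \<ge> 0" "\<And>k. q k = 0 \<Longrightarrow> w k * p k = 0"
    "rel_entropy R S = (\<Sum>k\<in>UNIV. w k * p k * (ln (p k) - ln (q k)))"
    "Re (trace R) = (\<Sum>k\<in>UNIV. w k * p k)" "Re (trace S) = (\<Sum>k\<in>UNIV. w k * q k)"
    "\<And>t X. t > 0 \<Longrightarrow> rel_functional t R S X \<le> (\<Sum>k\<in>UNIV. w k * p k * (p k / (q k + t * p k)))"
    "\<And>t. t > 0 \<Longrightarrow> \<exists>X. rel_functional t R S X = (\<Sum>k\<in>UNIV. w k * p k * (p k / (q k + t * p k)))"
    "\<And>f. Re (trace (R ** hfun f S)) = (\<Sum>k\<in>UNIV. w k * p k * f (q k))"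
proof -
  obtain V p where V: "unitary V" and p: "\<And>i. p i \<ge> 0" and R: "R = V ** diag p ** dagger V"
    using psd_spectral[OF \<open>psd R\<close>] by blast
  obtain U q where U: "unitary U" and q: "\<And>i. q i \<ge> 0" and S: "S = U ** diag q ** dagger U"
    using psd_spectral[OF \<open>psd S\<close>] by blast
  define W where "W = dagger U ** V"
  define w where "w k = (cmod (W $ fst k $ snd k))\<^sup>2" for k
  have W: "unitary W"
    unfolding W_def by (intro unitary_mult unitary_dagger U V)
  have columns: "(\<Sum>i\<in>UNIV. (cmod (W $ i $ j))\<^sup>2) = 1" for j
    by (rule unitary_columns[OF W])
  have rows: "(\<Sum>j\<in>UNIV. (cmod (W $ i $ j))\<^sup>2) = 1" for i
    using unitary_columns[OF unitary_dagger[OF W], of i] by simp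
  have pairs: "(\<Sum>k\<in>UNIV. f k) = (\<Sum>i\<in>UNIV. \<Sum>j\<in>UNIV. f (i, j))" for f :: "'n \<times> 'n \<Rightarrow> real"
    unfolding sum.cartesian_product by simp
  \<comment> \<open>The squared moduli of the unitary \<open>W\<close> are doubly stochastic, so the
    weights disappear from a sum that depends on one index only.\<close>
  have on_R: "(\<Sum>i\<in>UNIV. \<Sum>j\<in>UNIV. (cmod (W $ i $ j))\<^sup>2 * f j) = sum f UNIV" for f
    by (subst sum.swap) (simp add: columns flip: sum_distrib_right)
  have on_S: "(\<Sum>i\<in>UNIV. \<Sum>j\<in>UNIV. (cmod (W $ i $ j))\<^sup>2 * f i) = sum f UNIV" for f
    by (simp add: rows flip: sum_distrib_right)
  have functional: "rel_functional t R S X =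
      (\<Sum>k\<in>UNIV. 2 * Re (cnj ((dagger U ** X ** V) $ fst k $ snd k) * W $ fst k $ snd k) * p (snd k) -
        (cmod ((dagger U ** X ** V) $ fst k $ snd k))\<^sup>2 * (q (fst k) + t * p (snd k)))" for t X
  proof -
    define Z where "Z = dagger U ** X ** V"
    have "trace (dagger X ** R) = trace (dagger V ** (dagger X ** V ** diag p))"
      by (subst trace_cyclic[of "dagger V"]) (simp add: R matrix_mul_assoc)
    also have "dagger V ** (dagger X ** V ** diag p) = dagger Z ** W ** diag p"
      by (simp add: Z_def W_def dagger_mult matrix_mul_assoc[symmetric] unitary_cancel[OF U])
    also have "trace \<dots> = (\<Sum>j\<in>UNIV. \<Sum>i\<in>UNIV. cnj (Z $ i $ j) * W $ i $ j * p j)"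
      unfolding trace_def diag_mult_right
      by (simp add: matrix_matrix_mult_def[of "dagger Z"] sum_distrib_right)
    also have "\<dots> = (\<Sum>i\<in>UNIV. \<Sum>j\<in>UNIV. cnj (Z $ i $ j) * W $ i $ j * p j)"
      by (rule sum.swap)
    finally have 1: "Re (trace (dagger X ** R)) = (\<Sum>i\<in>UNIV. \<Sum>j\<in>UNIV. Re (cnj (Z $ i $ j) * W $ i $ j) * p j)"
      by simp
    have "trace (dagger X ** S ** X) = trace (dagger V ** (dagger X ** S ** X ** V))"
      by (subst trace_cyclic[of "dagger V"]) (simp add: matrix_mul_assoc[symmetric] V unitaryD)
    also have "dagger V ** (dagger X ** S ** X ** V) = dagger Z ** diag q ** dagger (dagger Z)"
      by (simp add: S Z_def dagger_mult matrix_mul_assoc)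
    also have "trace \<dots> = of_real (\<Sum>j\<in>UNIV. \<Sum>i\<in>UNIV. (cmod (Z $ i $ j))\<^sup>2 * q i)"
      unfolding trace_conj_diag' by simp
    also have "(\<Sum>j\<in>UNIV. \<Sum>i\<in>UNIV. (cmod (Z $ i $ j))\<^sup>2 * q i) = (\<Sum>i\<in>UNIV. \<Sum>j\<in>UNIV. (cmod (Z $ i $ j))\<^sup>2 * q i)"
      by (rule sum.swap)
    finally have 2: "Re (trace (dagger X ** S ** X)) = (\<Sum>i\<in>UNIV. \<Sum>j\<in>UNIV. (cmod (Z $ i $ j))\<^sup>2 * q i)"
      by simp
    have "trace (X ** R ** dagger X) = trace (dagger U ** (X ** R ** dagger X ** U))"
      by (subst trace_cyclic[of "dagger U"]) (simp add: matrix_mul_assoc[symmetric] U unitaryD)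
    also have "dagger U ** (X ** R ** dagger X ** U) = Z ** diag p ** dagger Z"
      by (simp add: R Z_def dagger_mult matrix_mul_assoc)
    finally have 3: "Re (trace (X ** R ** dagger X)) = (\<Sum>i\<in>UNIV. \<Sum>j\<in>UNIV. (cmod (Z $ i $ j))\<^sup>2 * p j)"
      unfolding trace_conj_diag' by simp
    show ?thesis
      unfolding rel_functional_def 1 2 3 pairs Z_def[symmetric]
      by (simp add: sum_distrib_left sum.distrib sum_subtractf algebra_simps)
  qed
  show thesis
  proof (rule that[of w "\<lambda>k. p (snd k)" "\<lambda>k. q (fst k)"])
    fix k :: "'n \<times> 'n"
    show "w k \<ge> 0" "p (snd k) \<ge> 0" "q (fst k) \<ge> 0"
      using p q by (auto simp: w_def)
    show "w k * p (snd k) = 0" if "q (fst k) = 0"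
    proof -
      define i where "i = fst k"
      \<comment> \<open>The kernel hypothesis is tested at the \<open>i\<close>-th eigenvector of
        \<open>S\<close>. The form of \<open>R\<close> there is a sum of nonnegative terms, so its
        vanishing kills every one of them.\<close>
      have "cinner (U *v axis i 1) (S *v (U *v axis i 1)) = of_real (q i)"
        unfolding S by (rule cinner_eigenvector[OF U])
      then have "cinner (U *v axis i 1) (R *v (U *v axis i 1)) = 0"
        using that \<open>ker_le S R\<close> by (simp add: ker_le_def i_def)
      then have "(\<Sum>j\<in>UNIV. p j * (cmod ((dagger V *v (U *v axis i 1)) $ j))\<^sup>2) = 0"
        unfolding R cinner_conj_diag by (simp only: of_real_eq_0_iff)
      moreover have "(dagger V *v (U *v axis i 1)) $ j = cnj (W $ i $ j)" for j
      proof -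
        have "(dagger V *v (U *v axis i 1)) $ j = (dagger W *v axis i 1) $ j"
          by (simp add: W_def dagger_mult matrix_vector_mul_assoc)
        then show ?thesis
          by (simp add: matrix_vector_mult_def axis_def if_distrib[of "\<lambda>x. _ * x"] cong: if_cong)
      qed
      ultimately have "p j * (cmod (W $ i $ j))\<^sup>2 = 0" for j
        using p by (subst (asm) sum_nonneg_eq_0_iff) auto
      from this[of "snd k"] show ?thesis
        by (auto simp: w_def i_def)
    qed
  next
    have cross: "trace (R ** hfun f S) = of_real (\<Sum>i\<in>UNIV. \<Sum>j\<in>UNIV. (cmod (W $ i $ j))\<^sup>2 * p j * f (q i))" for f
      unfolding R S hfun_eq[OF U] trace_conj_diag_mult W_def by simp
    show "Re (trace (R ** hfun f S)) = (\<Sum>k\<in>UNIV. w k * p (snd k) * f (q (fst k)))" for f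
      unfolding cross pairs w_def by simp
    have RR: "trace (R ** hfun ln R) = of_real (\<Sum>j\<in>UNIV. p j * ln (p j))"
      unfolding R hfun_eq[OF V] conj_diag_mult[OF V] trace_conj_diag[OF V] by simp
    have "rel_entropy R S = (\<Sum>i\<in>UNIV. \<Sum>j\<in>UNIV. (cmod (W $ i $ j))\<^sup>2 * (p j * ln (p j))) -
        (\<Sum>i\<in>UNIV. \<Sum>j\<in>UNIV. (cmod (W $ i $ j))\<^sup>2 * p j * ln (q i))"
      unfolding rel_entropy_def on_R by (simp add: cross RR)
    also have "\<dots> = (\<Sum>k\<in>UNIV. w k * p (snd k) * (ln (p (snd k)) - ln (q (fst k))))"
      unfolding pairs by (simp add: w_def algebra_simps sum_subtractf)
    finally show "rel_entropy R S = (\<Sum>k\<in>UNIV. w k * p (snd k) * (ln (p (snd k)) - ln (q (fst k))))" .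
    show "Re (trace R) = (\<Sum>k\<in>UNIV. w k * p (snd k))"
      unfolding R trace_conj_diag[OF V] pairs w_def by (simp add: on_R)
    show "Re (trace S) = (\<Sum>k\<in>UNIV. w k * q (fst k))"
      unfolding S trace_conj_diag[OF U] pairs w_def by (simp add: on_S)
  next
    fix t :: real assume t: "t > 0"
    show "rel_functional t R S X \<le> (\<Sum>k\<in>UNIV. w k * p (snd k) * (p (snd k) / (q (fst k) + t * p (snd k))))" for X
      unfolding functional w_def by (intro sum_mono scalar_functional t p q)
    \<comment> \<open>The entrywise maximiser of \<open>scalar_functional\<close>, carried back from
      the two eigenbases.\<close>
    define X where "X = U ** (\<chi> i j. W $ i $ j * of_real (p j / (q i + t * p j))) ** dagger V"
    have "dagger U ** X ** V = (\<chi> i j. W $ i $ j * of_real (p j / (q i + t * p j)))"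
      by (simp add: X_def matrix_mul_assoc[symmetric] unitary_cancel[OF U] unitaryD[OF V])
    then have "rel_functional t R S X = (\<Sum>k\<in>UNIV. w k * p (snd k) * (p (snd k) / (q (fst k) + t * p (snd k))))"
      unfolding functional w_def by (intro sum.cong refl scalar_functional(2) t p q) simp
    then show "\<exists>X. rel_functional t R S X = (\<Sum>k\<in>UNIV. w k * p (snd k) * (p (snd k) / (q (fst k) + t * p (snd k))))"
      by blast
  qed
qed

text \<open>Klein's inequality, from \<open>ln x \<le> x - 1\<close> at \<open>x = q k / p k\<close>
  in each term.\<close>

lemma rel_entropy_ge:
  assumes "psd R" "psd S" "ker_le S R"
  shows "rel_entropy R S \<ge> Re (trace R) - Re (trace S)"
proof (rule rel_entropy_decomposition[OF assms])
  fix w p q :: "'a \<times> 'a \<Rightarrow> real"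
  assume *: "\<And>k. w k \<ge> 0" "\<And>k. p k \<ge> 0" "\<And>k. q k \<ge> 0" "\<And>k. q k = 0 \<Longrightarrow> w k * p k = 0"
    "rel_entropy R S = (\<Sum>k\<in>UNIV. w k * p k * (ln (p k) - ln (q k)))"
    "Re (trace R) = (\<Sum>k\<in>UNIV. w k * p k)" "Re (trace S) = (\<Sum>k\<in>UNIV. w k * q k)"
  have "w k * p k - w k * q k \<le> w k * p k * (ln (p k) - ln (q k))" for k
  proof (cases "w k * p k = 0")
    case True
    then show ?thesis
      unfolding True using mult_nonneg_nonneg[OF *(1,3), of k k] by simp
  next
    case False
    then have pos: "p k > 0" "q k > 0"
      using *(2,3,4)[of k] by (auto simp: less_le)
    have "ln (q k / p k) \<le> q k / p k - 1"
      using pos by (intro ln_le_minus_one) simp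
    then have "p k * (ln (p k) - ln (q k)) \<ge> p k * (1 - q k / p k)"
      using pos by (intro mult_left_mono) (simp_all add: ln_div)
    then have "p k * (ln (p k) - ln (q k)) \<ge> p k - q k"
      using pos by (simp add: right_diff_distrib)
    then have "w k * (p k - q k) \<le> w k * (p k * (ln (p k) - ln (q k)))"
      using *(1) by (intro mult_left_mono)
    then show ?thesis by (simp add: algebra_simps)
  qed
  then show "rel_entropy R S \<ge> Re (trace R) - Re (trace S)"
    unfolding * sum_subtractf[symmetric] by (intro sum_mono)
qed

text \<open>
  The primitive \<open>G\<close> below replaces the integral representation
  \<open>-ln x = \<integral>\<^sub>0\<^sup>\<infinity> (1 / (x + t) - 1 / (1 + t)) dt\<close>.
\<close>

definition rel_primitive :: "'n::finite cmat \<Rightarrow> 'n cmat \<Rightarrow> (real \<Rightarrow> real) \<Rightarrow> (real \<Rightarrow> real) \<Rightarrow> bool" where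
  "rel_primitive R S F G \<longleftrightarrow> G 0 = 0 \<and> (\<forall>b. continuous_on {0..b} G) \<and>
     (\<forall>t>0. (G has_real_derivative F t) (at t)) \<and>
     ((\<lambda>t. G t - Re (trace R) * ln t) \<longlongrightarrow> rel_entropy R S) at_top \<and>
     (\<forall>t>0. \<forall>X. rel_functional t R S X \<le> F t) \<and> (\<forall>t>0. \<exists>X. rel_functional t R S X = F t)"

text \<open>\<open>G\<close> is the sum of
  \<open>w k * p k * (ln (q k + t * p k) - ln (q k))\<close>, differentiated term by term; each term
  grows like \<open>w k * p k * ln t\<close> and leaves its share of the relative entropy. Terms
  with \<open>w k * p k = 0\<close> are treated apart because \<open>q k\<close> may vanish
  there.\<close>

lemma rel_primitive_exists:
  fixes R S :: "'n::finite cmat"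
  assumes "psd R" "psd S" "ker_le S R"
  shows "\<exists>F G. rel_primitive R S F G"
proof (rule rel_entropy_decomposition[OF assms])
  fix w p q :: "'n \<times> 'n \<Rightarrow> real"
  assume w: "\<And>k. w k \<ge> 0" and p: "\<And>k. p k \<ge> 0" and q: "\<And>k. q k \<ge> 0"
    and zero: "\<And>k. q k = 0 \<Longrightarrow> w k * p k = 0"
    and D: "rel_entropy R S = (\<Sum>k\<in>UNIV. w k * p k * (ln (p k) - ln (q k)))"
    and tr: "Re (trace R) = (\<Sum>k\<in>UNIV. w k * p k)"
    and F: "\<And>t X. t > 0 \<Longrightarrow> rel_functional t R S X \<le> (\<Sum>k\<in>UNIV. w k * p k * (p k / (q k + t * p k)))"
      "\<And>t. t > 0 \<Longrightarrow> \<exists>X. rel_functional t R S X = (\<Sum>k\<in>UNIV. w k * p k * (p k / (q k + t * p k)))"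
  have pos: "p k > 0" "q k > 0" if "w k * p k \<noteq> 0" for k
    using that p[of k] q[of k] zero[of k] by (auto simp: less_le)
  define g where "g k t = w k * p k * (ln (q k + t * p k) - ln (q k))" for k t
  have g_zero: "g k = (\<lambda>t. 0)" if "w k * p k = 0" for k
    unfolding g_def that by simp
  have g0: "g k 0 = 0" for k
    by (simp add: g_def)
  have g_cont: "continuous_on {0..b} (g k)" for b k
  proof (cases "w k * p k = 0")
    case False
    have "q k + t * p k \<noteq> 0" if "t \<ge> 0" for t
      using add_pos_nonneg[of "q k" "t * p k"] pos[OF False] that by simp
    then show ?thesis
      unfolding g_def by (intro continuous_intros) auto
  qed (simp add: g_zero)
  have g_deriv: "(g k has_real_derivative w k * p k * (p k / (q k + t * p k))) (at t)" if "t > 0" for k t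
  proof (cases "w k * p k = 0")
    case False
    have "q k + t * p k > 0"
      using add_pos_pos[of "q k" "t * p k"] pos[OF False] that by simp
    then show ?thesis
      unfolding g_def by (auto intro!: derivative_eq_intros simp: divide_simps)
  next
    case True
    show ?thesis
      unfolding g_zero[OF True] True by simp
  qed
  have g_lim: "((\<lambda>t. g k t - w k * p k * ln t) \<longlongrightarrow> w k * p k * (ln (p k) - ln (q k))) at_top" for k
  proof (cases "w k * p k = 0")
    case False
    \<comment> \<open>Subtracting \<open>ln t\<close> turns \<open>q k + t * p k\<close> into
      \<open>q k / t + p k\<close>, which tends to \<open>p k > 0\<close>.\<close>
    have *: "((\<lambda>t. ln (q k * inverse t + p k) - ln (q k)) \<longlongrightarrow> ln (q k * 0 + p k) - ln (q k)) at_top"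
      using pos[OF False] by (intro tendsto_intros tendsto_inverse_0_at_top filterlim_ident) simp
    have "((\<lambda>t. w k * p k * (ln (q k * inverse t + p k) - ln (q k))) \<longlongrightarrow> w k * p k * (ln (p k) - ln (q k))) at_top"
      using tendsto_mult[OF tendsto_const[of "w k * p k"] *] by simp
    moreover have "eventually (\<lambda>t. w k * p k * (ln (q k * inverse t + p k) - ln (q k)) = g k t - w k * p k * ln t) at_top"
      using eventually_gt_at_top[of 0]
    proof eventually_elim
      case (elim t)
      have "q k + t * p k > 0"
        using add_pos_pos[of "q k" "t * p k"] pos[OF False] elim by simp
      moreover have "q k * inverse t + p k = (q k + t * p k) / t"
        using elim by (simp add: field_simps)
      ultimately have E: "ln (q k * inverse t + p k) = ln (q k + t * p k) - ln t"
        using elim by (simp add: ln_div)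
      show ?case
        unfolding g_def E by (simp add: right_diff_distrib)
    qed
    ultimately show ?thesis by (rule Lim_transform_eventually)
  next
    case True
    show ?thesis
      unfolding g_zero[OF True] True by simp
  qed
  have "((\<lambda>t. (\<Sum>k\<in>UNIV. g k t) - Re (trace R) * ln t) \<longlongrightarrow> rel_entropy R S) at_top"
    unfolding D tr sum_distrib_right sum_subtractf[symmetric] by (intro tendsto_sum g_lim)
  then have "rel_primitive R S (\<lambda>t. \<Sum>k\<in>UNIV. w k * p k * (p k / (q k + t * p k))) (\<lambda>t. \<Sum>k\<in>UNIV. g k t)"
    unfolding rel_primitive_def
    by (intro conjI allI impI continuous_on_sum DERIV_sum g_cont g_deriv F) (simp_all add: g0)
  then show ?thesis by blast
qed

text \<open>The comparison principle. Transferring the maximiser \<open>X\<close> to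
  \<open>Y\<close> and \<open>Z\<close> shows \<open>F t \<le> F1 t + F2 t\<close>, so
  \<open>G1 + G2 - G\<close> is nondecreasing and starts at 0. As \<open>t\<close> tends to infinity
  the trace hypothesis cancels the logarithms and the difference of the two sides remains.\<close>

lemma rel_entropy_le_add:
  fixes R S :: "'m::finite cmat" and R1 S1 R2 S2 :: "'n::finite cmat"
  assumes "psd R" "psd S" "ker_le S R"
    and "psd R1" "psd S1" "ker_le S1 R1"
    and "psd R2" "psd S2" "ker_le S2 R2"
    and tr: "Re (trace R) = Re (trace R1) + Re (trace R2)"
    and le: "\<And>t X. t > 0 \<Longrightarrow> \<exists>Y Z. rel_functional t R S X \<le> rel_functional t R1 S1 Y + rel_functional t R2 S2 Z"
  shows "rel_entropy R S \<le> rel_entropy R1 S1 + rel_entropy R2 S2"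
proof -
  obtain F G where G: "rel_primitive R S F G"
    using rel_primitive_exists[OF assms(1-3)] by blast
  obtain F1 G1 where G1: "rel_primitive R1 S1 F1 G1"
    using rel_primitive_exists[OF assms(4-6)] by blast
  obtain F2 G2 where G2: "rel_primitive R2 S2 F2 G2"
    using rel_primitive_exists[OF assms(7-9)] by blast
  note G = G[unfolded rel_primitive_def] and G1 = G1[unfolded rel_primitive_def]
    and G2 = G2[unfolded rel_primitive_def]
  have F_le: "F t \<le> F1 t + F2 t" if t: "t > 0" for t
  proof -
    obtain X where X: "rel_functional t R S X = F t"
      using G t by blast
    obtain Y Z where "rel_functional t R S X \<le> rel_functional t R1 S1 Y + rel_functional t R2 S2 Z"
      using le[OF t] by blast
    moreover have "rel_functional t R1 S1 Y \<le> F1 t" "rel_functional t R2 S2 Z \<le> F2 t"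
      using G1 G2 t by blast+
    ultimately show ?thesis
      using X by linarith
  qed
  define K where "K = (\<lambda>t. G1 t + G2 t - G t)"
  have "K t \<ge> 0" if "t > 0" for t
  proof -
    have "K 0 \<le> K t"
    proof (rule DERIV_nonneg_imp_increasing_open[where f = K and a = 0 and b = t])
      show "\<exists>y. (K has_real_derivative y) (at x) \<and> y \<ge> 0" if "0 < x" for x
        unfolding K_def using G G1 G2 F_le[OF that] that
        by (intro exI[of _ "F1 x + F2 x - F x"]) (auto intro!: derivative_intros)
      show "continuous_on {0..t} K"
        unfolding K_def using G G1 G2 by (intro continuous_intros) auto
    qed (use that in auto)
    then show ?thesis using G G1 G2 by (simp add: K_def)
  qed
  then have ev: "eventually (\<lambda>t. K t \<ge> 0) at_top"
    by (intro eventually_mono[OF eventually_gt_at_top[of 0]])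

  have lim: "((\<lambda>t. G t - Re (trace R) * ln t) \<longlongrightarrow> rel_entropy R S) at_top"
    "((\<lambda>t. G1 t - Re (trace R1) * ln t) \<longlongrightarrow> rel_entropy R1 S1) at_top"
    "((\<lambda>t. G2 t - Re (trace R2) * ln t) \<longlongrightarrow> rel_entropy R2 S2) at_top"
    using G G1 G2 by auto
  have "(K \<longlongrightarrow> rel_entropy R1 S1 + rel_entropy R2 S2 - rel_entropy R S) at_top"
    using tendsto_diff[OF tendsto_add[OF lim(2,3)] lim(1)] by (simp add: K_def tr algebra_simps)
  then have "0 \<le> rel_entropy R1 S1 + rel_entropy R2 S2 - rel_entropy R S"
    by (rule tendsto_lowerbound[OF _ ev]) simp
  then show ?thesis by simp
qed

section \<open>Positivity, kernels, joint convexity and antitonicity\<close>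

lemma trace_add_Re: "Re (trace (X + Y)) = Re (trace X) + Re (trace Y)"
  by (simp add: trace_add)

lemma psd_add: "psd X \<Longrightarrow> psd Y \<Longrightarrow> psd (X + Y)"
  by (simp add: psd_iff matrix_vector_mult_add_rdistrib cinner_add_right)

lemma psd_zero: "psd 0"
  by (simp add: psd_iff)

lemma psd_conj: "psd X \<Longrightarrow> psd (dagger Y ** X ** Y)"
proof -
  assume X: "psd X"
  have "cinner v (dagger Y ** X ** Y *v v) = cinner (Y *v v) (X *v (Y *v v))" for v
    by (simp add: matrix_vector_mul_assoc[symmetric] cinner_adjoint[of v])
  with X show ?thesis by (simp add: psd_iff)
qed

lemma trace_psd: "psd X \<Longrightarrow> Re (trace X) \<ge> 0"
  unfolding trace_def Re_sum
  by (intro sum_nonneg) (metis cinner_axis psd_iff)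

lemma ker_le_add:
  assumes "psd S1" "psd S2" "ker_le S1 R1" "ker_le S2 R2"
  shows "ker_le (S1 + S2) (R1 + R2)"
  unfolding ker_le_def
proof (intro allI impI)
  fix v assume *: "cinner v ((S1 + S2) *v v) = 0"
  have "cinner v (S1 *v v) = 0 \<and> cinner v (S2 *v v) = 0"
    using assms(1,2)[unfolded psd_iff, rule_format, of v] *
    by (auto simp: matrix_vector_mult_add_rdistrib cinner_add_right complex_eq_iff)
  then show "cinner v ((R1 + R2) *v v) = 0"
    using assms(3,4) by (simp add: ker_le_def matrix_vector_mult_add_rdistrib cinner_add_right)
qed

lemma ker_le_refl: "ker_le X X"
  by (simp add: ker_le_def)

lemma ker_le_psd_diff:
  assumes "psd R" "psd (S - R)"
  shows "ker_le S R"
  unfolding ker_le_def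
proof (intro allI impI)
  fix v assume "cinner v (S *v v) = 0"
  then show "cinner v (R *v v) = 0"
    using assms[unfolded psd_iff, THEN spec, of v]
    by (auto simp: matrix_vector_mult_diff_rdistrib cinner_diff_right complex_eq_iff)
qed

text \<open>For fixed \<open>X\<close> the functional is additive in the pair of operators, so the
  same \<open>X\<close> serves both summands.\<close>

lemma rel_entropy_joint_convex:
  assumes "psd R1" "psd S1" "ker_le S1 R1" "psd R2" "psd S2" "ker_le S2 R2"
  shows "rel_entropy (R1 + R2) (S1 + S2) \<le> rel_entropy R1 S1 + rel_entropy R2 S2"
proof (rule rel_entropy_le_add)
  fix t X
  have "rel_functional t (R1 + R2) (S1 + S2) X = rel_functional t R1 S1 X + rel_functional t R2 S2 X"
    by (simp add: rel_functional_def matrix_add_ldistrib matrix_add_rdistrib trace_add_Re algebra_simps)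
  then show "\<exists>Y Z. rel_functional t (R1 + R2) (S1 + S2) X \<le> rel_functional t R1 S1 Y + rel_functional t R2 S2 Z"
    by auto
qed (use assms in \<open>auto intro: psd_add ker_le_add simp: trace_add_Re\<close>)

lemma rel_entropy_zero [simp]: "rel_entropy 0 S = 0"
  by (simp add: rel_entropy_def trace_def)

text \<open>The second argument enters the functional only through a subtracted positive term, which
  grows with it. The pair \<open>(0, 0)\<close> fills the second slot of the comparison principle
  and contributes 0.\<close>

lemma rel_entropy_antimono:
  assumes "psd R" "psd S" "ker_le S R" "psd (S' - S)"
  shows "rel_entropy R S' \<le> rel_entropy R S"
proof -
  have S': "psd S'"
    using psd_add[OF \<open>psd S\<close> \<open>psd (S' - S)\<close>] by simp
  have "ker_le S' R"
    using ker_le_psd_diff[OF \<open>psd S\<close> \<open>psd (S' - S)\<close>] \<open>ker_le S R\<close> by (simp add: ker_le_def)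
  then have "rel_entropy R S' \<le> rel_entropy R S + rel_entropy 0 (0 :: 'a cmat)"
  proof (intro rel_entropy_le_add)
    fix t X
    have "rel_functional t R S X - rel_functional t R S' X = Re (trace (dagger X ** (S' - S) ** X))"
      by (simp add: rel_functional_def matrix_diff_ldistrib matrix_diff_rdistrib trace_sub)
    also have "\<dots> \<ge> 0"
      by (intro trace_psd psd_conj assms)
    finally have "rel_functional t R S' X \<le> rel_functional t R S X + rel_functional t 0 0 (0 :: 'a cmat)"
      by (simp add: rel_functional_def trace_def)
    then show "\<exists>Y Z. rel_functional t R S' X \<le> rel_functional t R S Y + rel_functional t 0 0 (Z :: 'a cmat)"
      by blast
  qed (use assms S' in \<open>auto intro: psd_zero ker_le_refl simp: trace_def\<close>)
  then show ?thesis by simp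
qed

lemma rel_entropy_le_0:
  assumes "psd R" "psd (S - R)"
  shows "rel_entropy R S \<le> 0"
  using rel_entropy_antimono[OF assms(1) assms(1) ker_le_refl assms(2)]
  by (simp add: rel_entropy_def)

subsection \<open>Monotonicity of relative entropy under channels\<close>

lemma cinner_sum_left: "cinner (sum f A) w = (\<Sum>a\<in>A. cinner (f a) w)"
  by (induction A rule: infinite_finite_induct) (simp_all add: cinner_add_left)

lemma cinner_sum_right: "cinner w (sum f A) = (\<Sum>a\<in>A. cinner w (f a))"
  by (induction A rule: infinite_finite_induct) (simp_all add: cinner_add_right)

lemma matrix_vector_mult_sum: "X *v sum f A = (\<Sum>a\<in>A. X *v f a)" for X :: "'n::finite cmat"
  by (induction A rule: infinite_finite_induct) (simp_all add: matrix_vector_right_distrib)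

lemma trace_mult_expand: "trace (dagger X ** Y) = (\<Sum>i\<in>UNIV. \<Sum>j\<in>UNIV. cnj (X $ i $ j) * Y $ i $ j)"
  unfolding trace_def by (subst sum.swap) (simp add: matrix_matrix_mult_def)

lemma trace_sum: "trace (sum f A) = (\<Sum>a\<in>A. trace (f a :: 'n::finite cmat))"
  by (simp add: trace_def) (rule sum.swap)

lemma matrix_mult_zero: "X ** 0 = 0" for X :: "'n::finite cmat"
  by (simp add: vec_eq_iff matrix_matrix_mult_def)

lemma matrix_mult_sum: "X ** sum f A = (\<Sum>a\<in>A. X ** f a)" for X :: "'n::finite cmat"
  by (induction A rule: infinite_finite_induct)
    (simp_all add: matrix_add_ldistrib matrix_mult_zero)

lemma mscale_mult: "X ** mscale c Y = mscale c (X ** Y)" "mscale c X ** Y = mscale c (X ** Y)"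
  by (simp_all add: vec_eq_iff mscale_def matrix_matrix_mult_def sum_distrib_left mult_ac)

lemma trace_mscale: "trace (mscale c X) = c * trace X"
  by (simp add: trace_def mscale_def sum_distrib_left)

lemma dagger_mat_1: "dagger (mat 1) = mat 1"
  by (simp add: vec_eq_iff mat_def)

text \<open>\<open>Y\<close> is the Hilbert-Schmidt adjoint applied to \<open>X\<close>; its entries
  are read off from the values of \<open>\<Phi>\<close> on the matrix units
  \<open>E i j\<close>.\<close>

lemma linear_adjoint:
  fixes \<Phi> :: "'m::finite cmat \<Rightarrow> 'n::finite cmat"
  assumes "Vector_Spaces.linear mscale mscale \<Phi>"
  shows "\<exists>Y. \<forall>S. trace (dagger X ** \<Phi> S) = trace (dagger Y ** S)"
proof -
  interpret \<Phi>: Vector_Spaces.linear mscale mscale \<Phi> by (fact assms)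
  define E :: "'m \<Rightarrow> 'm \<Rightarrow> 'm cmat" where "E i j = (\<chi> r c. if r = i \<and> c = j then 1 else 0)" for i j
  define Y where "Y = (\<chi> i j. cnj (trace (dagger X ** \<Phi> (E i j))))"
  have "trace (dagger X ** \<Phi> S) = trace (dagger Y ** S)" for S
  proof -
    have single: "(\<Sum>x\<in>UNIV. \<Sum>y\<in>UNIV. if i = x \<and> j = y then S $ x $ y else 0) = S $ i $ j" for i j
    proof -
      have "(\<Sum>y\<in>UNIV. if i = x \<and> j = y then S $ x $ y else 0) = (if i = x then S $ x $ j else 0)" for x
        by simp
      then show ?thesis by simp
    qed
    have "S = (\<Sum>i\<in>UNIV. \<Sum>j\<in>UNIV. mscale (S $ i $ j) (E i j))"
      by (simp add: vec_eq_iff mscale_def E_def if_distrib[of "\<lambda>x. _ * x"] single cong: if_cong)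
    then have "\<Phi> S = \<Phi> (\<Sum>i\<in>UNIV. \<Sum>j\<in>UNIV. mscale (S $ i $ j) (E i j))"
      by simp
    then show ?thesis
      by (simp add: \<Phi>.sum \<Phi>.scale matrix_mult_sum mscale_mult trace_sum trace_mscale trace_mult_expand[of Y])
         (simp add: Y_def mult.commute)
  qed
  then show ?thesis by blast
qed

section \<open>Consequences of complete positivity\<close>

lemma block_psd_sandwich:
  assumes "psd R"
  shows "block_psd n (\<lambda>i j. M i ** R ** dagger (M j))"
  unfolding block_psd_def
proof
  fix v :: "nat \<Rightarrow> complex ^ 'a"
  define w where "w = (\<Sum>i<n. dagger (M i) *v v i)"
  have "(\<Sum>i<n. \<Sum>j<n. cinner (v i) (M i ** R ** dagger (M j) *v v j)) =
      (\<Sum>i<n. \<Sum>j<n. cinner (dagger (M i) *v v i) (R *v (dagger (M j) *v v j)))"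
    by (simp add: matrix_vector_mul_assoc[symmetric] cinner_adjoint[of _ "M _"])
  also have "\<dots> = cinner w (R *v w)"
    by (simp add: w_def cinner_sum_left cinner_sum_right matrix_vector_mult_sum) (rule sum.swap)
  finally show "(\<Sum>i<n. \<Sum>j<n. cinner (v i) (M i ** R ** dagger (M j) *v v j)) \<in> \<real>\<^sub>\<ge>\<^sub>0"
    using assms by (simp add: psd_def)
qed

text \<open>Positivity at level two, applied to \<open>R\<close> sandwiched by the column with
  entries \<open>M\<close> and \<open>N\<close>. This is the form in which complete positivity
  enters the Schwarz inequality.\<close>

lemma cp_two_blocks:
  assumes "completely_positive \<Phi>" "psd R"
  shows "cinner v (\<Phi> (M ** R ** dagger M) *v v) + cinner v (\<Phi> (M ** R ** dagger N) *v w) +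
    cinner w (\<Phi> (N ** R ** dagger M) *v v) + cinner w (\<Phi> (N ** R ** dagger N) *v w) \<in> \<real>\<^sub>\<ge>\<^sub>0"
proof -
  define K where "K i = (if i = (0 :: nat) then M else N)" for i
  define u where "u i = (if i = (0 :: nat) then v else w)" for i
  have "block_psd 2 (\<lambda>i j. \<Phi> (K i ** R ** dagger (K j)))"
    using assms block_psd_sandwich[OF \<open>psd R\<close>, of 2 K] unfolding completely_positive_def by blast
  then have "(\<Sum>i<2. \<Sum>j<2. cinner (u i) (\<Phi> (K i ** R ** dagger (K j)) *v u j)) \<in> \<real>\<^sub>\<ge>\<^sub>0"
    unfolding block_psd_def by blast
  then show ?thesis
    by (simp add: numeral_2_eq_2 K_def u_def add_ac)
qed

lemma psd_mat_1: "psd (mat 1)"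
  by (simp add: psd_iff cinner_self)

text \<open>For the column \<open>Q\<close>, \<open>mat 1\<close> the diagonal terms of the
  two-block form are real, hence so is the sum of the mixed terms; evaluating at \<open>w\<close>
  and at \<open>\<i> *s w\<close> identifies them as conjugates.\<close>

lemma cp_dagger:
  fixes \<Phi> :: "'m::finite cmat \<Rightarrow> 'n::finite cmat"
  assumes "completely_positive \<Phi>"
  shows "\<Phi> (dagger Q) = dagger (\<Phi> Q)"
proof -
  note * = cp_two_blocks[OF assms psd_mat_1, of _ Q "mat 1", simplified dagger_mat_1 matrix_mul_lid matrix_mul_rid]
  have diag: "Im (cinner v (\<Phi> (Q ** dagger Q) *v v)) = 0" "Im (cinner v (\<Phi> (mat 1) *v v)) = 0" for v
    using *[of v 0] *[of 0 v] by (auto simp: complex_nonneg_Reals_iff)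
  have "cinner v (\<Phi> Q *v w) = cnj (cinner w (\<Phi> (dagger Q) *v v))" for v w
  proof -
    have 1: "Im (cinner v (\<Phi> Q *v w) + cinner w (\<Phi> (dagger Q) *v v)) = 0" for w
      using *[of v w] diag[of v] diag[of w] by (auto simp: complex_nonneg_Reals_iff)
    show ?thesis
      using 1[of w] 1[of "\<i> *s w"]
      by (simp add: cinner_scale_left cinner_scale_right matrix_vector_scale complex_eq_iff)
  qed
  from this[of "axis i 1" "axis j 1" for i j] have "\<Phi> Q $ i $ j = cnj (\<Phi> (dagger Q) $ j $ i)" for i j
    unfolding cinner_axis .
  then show ?thesis
    by (simp add: vec_eq_iff)
qed

lemma trace_sandwich: "(\<Sum>k\<in>UNIV. cinner (X *v axis k 1) (A *v (Y *v axis k 1))) = trace (dagger X ** A ** Y)"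
proof -
  have "cinner (X *v axis k 1) (A *v (Y *v axis k 1)) = (dagger X ** A ** Y) $ k $ k" for k
  proof -
    have "cinner (X *v axis k 1) (A *v (Y *v axis k 1)) = cinner (axis k 1) (dagger X ** A ** Y *v axis k 1)"
      by (simp add: matrix_vector_mul_assoc[symmetric] cinner_adjoint[of _ "dagger X"])
    then show ?thesis by (simp add: cinner_axis)
  qed
  then show ?thesis by (simp add: trace_def)
qed

text \<open>The Kadison-Schwarz inequality for the adjoint map, with \<open>Y\<close> the adjoint
  applied to \<open>X\<close>. The two-block form for \<open>mat 1\<close> and
  \<open>dagger Y\<close> at the vectors \<open>X *v axis k 1\<close> and \<open>- axis k 1\<close>,
  summed over \<open>k\<close>, is the right side minus twice the left side plus the trace of
  \<open>\<Phi> (dagger Y ** S ** Y)\<close>, and trace preservation makes this last term equal to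
  the left side.\<close>

lemma cptp_schwarz:
  fixes \<Phi> :: "'m::finite cmat \<Rightarrow> 'n::finite cmat"
  assumes \<Phi>: "cptp \<Phi>" and "psd S"
    and adj: "\<And>Q. trace (dagger X ** \<Phi> Q) = trace (dagger Y ** Q)"
  shows "Re (trace (dagger Y ** S ** Y)) \<le> Re (trace (dagger X ** \<Phi> S ** X))"
proof -
  have cp: "completely_positive \<Phi>" and tp: "\<And>Q. trace (\<Phi> Q) = trace Q"
    using \<Phi> by (auto simp: cptp_def)
  have S: "dagger S = S"
    by (rule psd_hermitian[OF \<open>psd S\<close>])
  note * = cp_two_blocks[OF cp \<open>psd S\<close>, of _ "mat 1" "dagger Y",
      unfolded dagger_mat_1 dagger_dagger matrix_mul_lid matrix_mul_rid]
  have neg: "cinner (- v) w = - cinner v w" "cinner w (- v) = - cinner w v"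
    "A *v (- v) = - (A *v v)" for v w :: "complex^'n" and A :: "'n cmat"
    using cinner_diff_left[of 0 v w] cinner_diff_right[of w 0 v] matrix_vector_mult_diff_distrib[of A 0 v]
    by simp_all
  define x where "x k = X *v axis k 1" for k
  \<comment> \<open>The factor \<open>mat 1\<close> gives the basis vector the shape that
    \<open>trace_sandwich\<close> expects.\<close>
  define e :: "'n \<Rightarrow> complex^'n" where "e k = mat 1 *v axis k 1" for k
  have "0 \<le> (\<Sum>k\<in>UNIV. Re (cinner (x k) (\<Phi> S *v x k) - cinner (x k) (\<Phi> (S ** Y) *v e k) -
      cinner (e k) (\<Phi> (dagger Y ** S) *v x k) + cinner (e k) (\<Phi> (dagger Y ** S ** Y) *v e k)))"
    using *[of "x _" "- e _"] by (intro sum_nonneg) (simp add: neg complex_nonneg_Reals_iff)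
  also have "\<dots> = Re (\<Sum>k\<in>UNIV. cinner (x k) (\<Phi> S *v x k) - cinner (x k) (\<Phi> (S ** Y) *v e k) -
      cinner (e k) (\<Phi> (dagger Y ** S) *v x k) + cinner (e k) (\<Phi> (dagger Y ** S ** Y) *v e k))"
    by (rule Re_sum[symmetric])
  also have "\<dots> = Re (trace (dagger X ** \<Phi> S ** X) - trace (dagger X ** \<Phi> (S ** Y)) -
      trace (\<Phi> (dagger Y ** S) ** X) + trace (\<Phi> (dagger Y ** S ** Y)))"
    unfolding sum.distrib sum_subtractf x_def e_def trace_sandwich by (simp add: dagger_mat_1)
  also have "trace (dagger X ** \<Phi> (S ** Y)) = trace (dagger Y ** S ** Y)"
    by (simp add: adj matrix_mul_assoc)
  also have "trace (\<Phi> (dagger Y ** S) ** X) = cnj (trace (dagger Y ** S ** Y))"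
  proof -
    have "\<Phi> (dagger Y ** S) = dagger (\<Phi> (S ** Y))"
      using cp_dagger[OF cp, of "S ** Y"] by (simp add: dagger_mult S)
    then have "\<Phi> (dagger Y ** S) ** X = dagger (dagger X ** \<Phi> (S ** Y))"
      by (simp add: dagger_mult)
    then show ?thesis
      by (simp add: trace_dagger adj matrix_mul_assoc)
  qed
  also have "trace (\<Phi> (dagger Y ** S ** Y)) = trace (dagger Y ** S ** Y)"
    by (rule tp)
  finally show ?thesis by simp
qed

lemma cptp_psd:
  assumes "cptp \<Phi>" "psd R"
  shows "psd (\<Phi> R)"
  unfolding psd_def
proof
  fix v show "cinner v (\<Phi> R *v v) \<in> \<real>\<^sub>\<ge>\<^sub>0"
    using assms cp_two_blocks[of \<Phi> R v "mat 1" 0 0] by (simp add: cptp_def dagger_mat_1)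
qed

theorem data_processing:
  fixes \<Phi> :: "'m::finite cmat \<Rightarrow> 'n::finite cmat"
  assumes \<Phi>: "cptp \<Phi>" and "psd R" "psd S" "ker_le S R" "ker_le (\<Phi> S) (\<Phi> R)"
  shows "rel_entropy (\<Phi> R) (\<Phi> S) \<le> rel_entropy R S"
proof -
  have lin: "Vector_Spaces.linear mscale mscale \<Phi>" and cp: "completely_positive \<Phi>"
    and tp: "\<And>Q. trace (\<Phi> Q) = trace Q"
    using \<Phi> by (auto simp: cptp_def)
  have "rel_entropy (\<Phi> R) (\<Phi> S) \<le> rel_entropy R S + rel_entropy 0 (0 :: 'm cmat)"
  proof (rule rel_entropy_le_add)
    fix t :: real and X assume "t > 0"
    obtain Y where Y: "\<And>Q. trace (dagger X ** \<Phi> Q) = trace (dagger Y ** Q)"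
      using linear_adjoint[OF lin] by blast
    \<comment> \<open>The term of the functional containing \<open>R\<close> has \<open>X\<close> on
      the left, so the Schwarz inequality is applied to \<open>dagger X\<close> there. Its adjoint
      image is \<open>dagger Y\<close> because \<open>\<Phi>\<close> commutes with
      \<open>dagger\<close>.\<close>
    have Y': "trace (dagger (dagger X) ** \<Phi> Q) = trace (dagger (dagger Y) ** Q)" for Q
    proof -
      have "trace (X ** \<Phi> Q) = cnj (trace (dagger (\<Phi> Q) ** dagger X))"
        by (simp add: trace_dagger[symmetric] dagger_mult)
      also have "\<dots> = cnj (trace (dagger Y ** dagger Q))"
        by (subst trace_cyclic) (simp add: cp_dagger[OF cp, symmetric] Y)
      also have "\<dots> = trace (Q ** Y)"
        by (simp add: trace_dagger[symmetric] dagger_mult)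
      finally show ?thesis
        by (simp add: trace_cyclic[of Y])
    qed
    have "t * Re (trace (Y ** R ** dagger Y)) \<le> t * Re (trace (X ** \<Phi> R ** dagger X))"
      using cptp_schwarz[OF \<Phi> \<open>psd R\<close> Y'] \<open>t > 0\<close> by simp
    then have "rel_functional t (\<Phi> R) (\<Phi> S) X \<le> rel_functional t R S Y + rel_functional t 0 0 (0 :: 'm cmat)"
      using cptp_schwarz[OF \<Phi> \<open>psd S\<close> Y] by (simp add: rel_functional_def Y trace_def[of 0])
    then show "\<exists>Y Z. rel_functional t (\<Phi> R) (\<Phi> S) X \<le> rel_functional t R S Y + rel_functional t 0 0 (Z :: 'm cmat)"
      by blast
  qed (use assms cptp_psd[OF \<Phi>] in \<open>auto simp: tp psd_zero ker_le_refl trace_def[of 0]\<close>)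
  then show ?thesis by simp
qed

subsection \<open>Bipartite systems\<close>

definition ptrace :: "('a::finite \<times> 'b::finite) cmat \<Rightarrow> 'b cmat" where
  "ptrace X = (\<chi> i j. \<Sum>a\<in>UNIV. X $ (a, i) $ (a, j))"

definition block :: "'a::finite \<Rightarrow> 'a \<Rightarrow> ('a \<times> 'b::finite) cmat \<Rightarrow> 'b cmat" where
  "block a a' X = (\<chi> i j. X $ (a, i) $ (a', j))"

definition slice :: "'a::finite \<Rightarrow> complex ^ ('a \<times> 'b::finite) \<Rightarrow> complex ^ 'b" where
  "slice a v = (\<chi> i. v $ (a, i))"

lemma sum_pairs: "(\<Sum>p\<in>UNIV. f p) = (\<Sum>a\<in>UNIV. \<Sum>i\<in>UNIV. f (a, i))"
  for f :: "'a::finite \<times> 'b::finite \<Rightarrow> 'c::comm_monoid_add"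
  unfolding sum.cartesian_product by simp

lemma cinner_blocks:
  "cinner v (X *v w) = (\<Sum>a\<in>UNIV. \<Sum>a'\<in>UNIV. cinner (slice a v) (block a a' X *v slice a' w))"
proof -
  have "(\<Sum>i\<in>UNIV. \<Sum>a'\<in>UNIV. f i a') = (\<Sum>a'\<in>UNIV. \<Sum>i\<in>UNIV. f i a')" for f :: "'b \<Rightarrow> 'a \<Rightarrow> complex"
    by (rule sum.swap)
  then show ?thesis
    by (simp add: cinner_mult_expand sum_pairs block_def slice_def)
qed

lemma block_id_tensor: "block a a' (id_tensor \<Phi> S) = \<Phi> (block a a' S)"
  by (simp add: vec_eq_iff block_def id_tensor_def)

lemma ptrace_blocks: "ptrace X = (\<Sum>a\<in>UNIV. block a a X)"
  by (simp add: vec_eq_iff ptrace_def block_def)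

lemma trace_ptrace: "trace (ptrace X) = trace X"
  unfolding trace_def ptrace_def by (simp add: sum_pairs) (rule sum.swap)

text \<open>Extending \<open>id_tensor \<Phi>\<close> by an \<open>n\<close>-dimensional identity
  amounts to extending \<open>\<Phi>\<close> by an identity of dimension
  \<open>n * CARD('a)\<close>. The bijection \<open>e\<close> numbers the pairs of a block index and
  a basis index of the first factor.\<close>

lemma cp_id_tensor:
  fixes \<Phi> :: "'m::finite cmat \<Rightarrow> 'n::finite cmat"
  assumes cp: "completely_positive \<Phi>"
  shows "completely_positive (id_tensor \<Phi> :: ('a::finite \<times> 'm) cmat \<Rightarrow> ('a \<times> 'n) cmat)"
  unfolding completely_positive_def
proof (intro allI impI)
  fix n and X :: "nat \<Rightarrow> nat \<Rightarrow> ('a \<times> 'm) cmat"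
  assume X: "block_psd n X"
  define I where "I = {..<n} \<times> (UNIV :: 'a set)"
  obtain e where e: "bij_betw e {..<card I} I"
    using ex_bij_betw_nat_finite[of I] by (auto simp: I_def atLeast0LessThan)
  define e' where "e' = inv_into {..<card I} e"
  have e': "e' (e k) = k" if "k < card I" for k
    unfolding e'_def using e that by (auto simp: bij_betw_def)
  have reindex: "(\<Sum>k<card I. \<Sum>l<card I. f (e k) (e l)) =
      (\<Sum>i<n. \<Sum>j<n. \<Sum>a\<in>UNIV. \<Sum>a'\<in>UNIV. f (i, a) (j, a'))"
    for f :: "nat \<times> 'a \<Rightarrow> nat \<times> 'a \<Rightarrow> complex"
  proof -
    have prod: "(\<Sum>p\<in>I. g p) = (\<Sum>i<n. \<Sum>a\<in>UNIV. g (i, a))" for g :: "nat \<times> 'a \<Rightarrow> complex"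
      by (simp add: I_def sum.cartesian_product)
    have "(\<Sum>k<card I. \<Sum>l<card I. f (e k) (e l)) = (\<Sum>p\<in>I. \<Sum>q\<in>I. f p q)"
      by (simp only: sum.reindex_bij_betw[OF e, of "\<lambda>p. \<Sum>q\<in>I. f p q"]
          sum.reindex_bij_betw[OF e, of "f (e k)" for k])
    also have "\<dots> = (\<Sum>i<n. \<Sum>a\<in>UNIV. \<Sum>j<n. \<Sum>a'\<in>UNIV. f (i, a) (j, a'))"
      by (simp only: prod)
    also have "\<dots> = (\<Sum>i<n. \<Sum>j<n. \<Sum>a\<in>UNIV. \<Sum>a'\<in>UNIV. f (i, a) (j, a'))"
      by (intro sum.cong refl sum.swap)
    finally show ?thesis .
  qed
  define X' where "X' k l = block (snd (e k)) (snd (e l)) (X (fst (e k)) (fst (e l)))" for k l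
  have "block_psd (card I) X'"
    unfolding block_psd_def
  proof
    fix u :: "nat \<Rightarrow> complex ^ 'm"
    define v where "v i = (\<chi> p. u (e' (i, fst p)) $ snd p)" for i
    have slice_v: "slice a (v i) = u (e' (i, a))" for i a
      by (simp add: slice_def v_def vec_eq_iff)
    have "(\<Sum>k<card I. \<Sum>l<card I. cinner (u k) (X' k l *v u l)) =
        (\<Sum>k<card I. \<Sum>l<card I. cinner (u (e' (e k))) (X' k l *v u (e' (e l))))"
      by (intro sum.cong refl) (simp add: e')
    also have "\<dots> = (\<Sum>i<n. \<Sum>j<n. \<Sum>a\<in>UNIV. \<Sum>a'\<in>UNIV. cinner (u (e' (i, a))) (block a a' (X i j) *v u (e' (j, a'))))"
      unfolding X'_def
      using reindex[of "\<lambda>p q. cinner (u (e' p)) (block (snd p) (snd q) (X (fst p) (fst q)) *v u (e' q))"] by simp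
    also have "\<dots> = (\<Sum>i<n. \<Sum>j<n. cinner (v i) (X i j *v v j))"
      by (simp add: cinner_blocks slice_v)
    finally show "(\<Sum>k<card I. \<Sum>l<card I. cinner (u k) (X' k l *v u l)) \<in> \<real>\<^sub>\<ge>\<^sub>0"
      using X by (simp add: block_psd_def)
  qed
  then have *: "block_psd (card I) (\<lambda>k l. \<Phi> (X' k l))"
    using cp by (simp add: completely_positive_def)
  show "block_psd n (\<lambda>i j. id_tensor \<Phi> (X i j))"
    unfolding block_psd_def
  proof
    fix v :: "nat \<Rightarrow> complex ^ ('a \<times> 'n)"
    have "(\<Sum>i<n. \<Sum>j<n. cinner (v i) (id_tensor \<Phi> (X i j) *v v j)) =
        (\<Sum>k<card I. \<Sum>l<card I. cinner (slice (snd (e k)) (v (fst (e k)))) (\<Phi> (X' k l) *v slice (snd (e l)) (v (fst (e l)))))"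
      unfolding X'_def cinner_blocks block_id_tensor
      using reindex[of "\<lambda>p q. cinner (slice (snd p) (v (fst p))) (\<Phi> (block (snd p) (snd q) (X (fst p) (fst q))) *v slice (snd q) (v (fst q)))"]
      by simp
    then show "(\<Sum>i<n. \<Sum>j<n. cinner (v i) (id_tensor \<Phi> (X i j) *v v j)) \<in> \<real>\<^sub>\<ge>\<^sub>0"
      using * by (simp add: block_psd_def)
  qed
qed

lemma trace_blocks: "trace X = (\<Sum>a\<in>UNIV. trace (block a a X))"
  by (simp add: trace_def sum_pairs block_def)

lemma trace_id_tensor:
  assumes "\<And>Q. trace (\<Phi> Q) = trace Q"
  shows "trace (id_tensor \<Phi> S) = trace S"
  by (simp add: trace_blocks[of "id_tensor \<Phi> S"] trace_blocks[of S] block_id_tensor assms)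

lemma cptp_id_tensor: "cptp \<Phi> \<Longrightarrow> cptp (id_tensor \<Phi>)"
  by (simp add: cptp_def linear_id_tensor cp_id_tensor trace_id_tensor)

lemma ptrace_id_tensor:
  assumes "Vector_Spaces.linear mscale mscale \<Phi>"
  shows "ptrace (id_tensor \<Phi> S) = \<Phi> (ptrace S)"
proof -
  interpret \<Phi>: Vector_Spaces.linear mscale mscale \<Phi> by (fact assms)
  show ?thesis by (simp add: ptrace_blocks \<Phi>.sum block_id_tensor)
qed

subsection \<open>Entropy\<close>

lemma mscale_vector: "mscale c X *v v = c *s (X *v v)"
  by (simp add: vec_eq_iff mscale_def matrix_vector_mult_def sum_distrib_left mult.assoc)

lemma mscale_conj_diag: "mscale (of_real c) (U ** diag d ** dagger U) = U ** diag (\<lambda>i. c * d i) ** dagger U"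
proof -
  have "diag (\<lambda>i. c * d i) = mscale (of_real c) (diag d)"
    by (simp add: vec_eq_iff diag_def mscale_def)
  then show ?thesis by (simp add: mscale_mult)
qed

lemma conj_diag_diff:
  "U ** diag d ** dagger U - U ** diag e ** dagger U = U ** diag (\<lambda>i. d i - e i) ** dagger U"
proof -
  have "diag (\<lambda>i. d i - e i) = diag d - diag e"
    by (auto simp: vec_eq_iff diag_def)
  then show ?thesis
    by (simp add: matrix_diff_ldistrib matrix_diff_rdistrib)
qed

lemma hfun_mscale:
  assumes "dagger S = S"
  shows "hfun f (mscale (of_real c) S) = hfun (\<lambda>x. f (c * x)) S"
proof -
  obtain U q where U: "unitary U" and S: "S = U ** diag q ** dagger U"
    using spectral[OF assms] by blast
  show ?thesis
    unfolding S mscale_conj_diag hfun_eq[OF U] by (simp add: o_def)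
qed

lemma rel_entropy_mscale:
  assumes "psd R" "psd S" "ker_le S R" "c > 0"
  shows "rel_entropy R (mscale (of_real c) S) = rel_entropy R S - Re (trace R) * ln c"
proof (rule rel_entropy_decomposition[OF assms(1-3)])
  fix w p q :: "'a \<times> 'a \<Rightarrow> real"
  assume q: "\<And>k. q k \<ge> 0" and zero: "\<And>k. q k = 0 \<Longrightarrow> w k * p k = 0"
    and tr: "Re (trace R) = (\<Sum>k\<in>UNIV. w k * p k)"
    and cross: "\<And>f. Re (trace (R ** hfun f S)) = (\<Sum>k\<in>UNIV. w k * p k * f (q k))"
  have "w k * p k * ln (c * q k) = w k * p k * ln (q k) + w k * p k * ln c" for k
  proof (cases "q k = 0")
    case False
    then have "ln (c * q k) = ln c + ln (q k)"
      using q[of k] \<open>c > 0\<close> by (simp add: ln_mult_pos less_le)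
    then show ?thesis by (simp add: algebra_simps)
  qed (simp only: zero mult_zero_left add_0)
  then show ?thesis
    unfolding rel_entropy_def hfun_mscale[OF psd_hermitian[OF \<open>psd S\<close>]] cross tr
    by (simp add: sum.distrib sum_distrib_right)
qed

definition neg_entropy :: "'n::finite cmat \<Rightarrow> real" where
  "neg_entropy X = Re (trace (X ** hfun ln X))"

lemma entropy_neg_entropy:
  assumes "psd X"
  shows "entropy k X = - neg_entropy X / ln k"
proof -
  obtain U d where U: "unitary U" and X: "X = U ** diag d ** dagger U"
    using psd_spectral[OF assms] by blast
  show ?thesis
    unfolding entropy_def neg_entropy_def X hfun_eq[OF U] conj_diag_mult[OF U] trace_conj_diag[OF U]
    by (simp add: log_def sum_divide_distrib)
qed

text \<open>Each of \<open>X\<close> and \<open>Y\<close> lies below \<open>X + Y\<close>, so both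
  relative entropies to \<open>X + Y\<close> are nonpositive; their sum is the claim.\<close>

lemma neg_entropy_add_ge:
  assumes "psd X" "psd Y"
  shows "neg_entropy X + neg_entropy Y \<le> neg_entropy (X + Y)"
proof -
  have "rel_entropy X (X + Y) \<le> 0" "rel_entropy Y (X + Y) \<le> 0"
    using assms by (auto intro!: rel_entropy_le_0)
  then show ?thesis
    by (simp add: rel_entropy_def neg_entropy_def matrix_add_rdistrib trace_add)
qed

lemma conj_diag_const:
  assumes "unitary U"
  shows "mscale (of_real c) (mat 1) = U ** diag (\<lambda>i. c) ** dagger U"
proof -
  have "diag (\<lambda>i. 1) = (mat 1 :: 'a cmat)"
    by (simp add: vec_eq_iff diag_def mat_def)
  then show ?thesis
    using mscale_conj_diag[of c U "\<lambda>i. 1"] by (simp add: unitaryD[OF assms])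
qed

lemma psd_le_trace:
  assumes "psd X"
  shows "psd (mscale (of_real (Re (trace X))) (mat 1) - X)"
proof -
  obtain U d where U: "unitary U" and d: "\<And>i. d i \<ge> 0" and X: "X = U ** diag d ** dagger U"
    using psd_spectral[OF assms] by blast
  have "mscale (of_real (Re (trace X))) (mat 1) - X = U ** diag (\<lambda>i. Re (trace X) - d i) ** dagger U"
    unfolding conj_diag_const[OF U] by (subst (2) X) (rule conj_diag_diff)
  moreover have "Re (trace X) = sum d UNIV"
    unfolding X trace_conj_diag[OF U] by simp
  moreover have "d i \<le> sum d UNIV" for i
    using d by (intro member_le_sum) auto
  ultimately show ?thesis
    by (simp add: psd_conj_diag)
qed

lemma unitary_mat_1: "unitary (mat 1)"
  by (simp add: unitary_def dagger_mat_1)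

lemma rel_entropy_scalar:
  "rel_entropy X (mscale (of_real c) (mat 1)) = neg_entropy X - Re (trace X) * ln c"
proof -
  have "hfun ln (mscale (of_real c) (mat 1)) = mscale (of_real (ln c)) (mat 1 :: 'a cmat)"
    unfolding conj_diag_const[OF unitary_mat_1] hfun_eq[OF unitary_mat_1] by (simp add: o_def)
  then show ?thesis
    by (simp add: rel_entropy_def neg_entropy_def mscale_mult trace_mscale mult.commute)
qed

text \<open>Joint convexity with the multiples \<open>x\<close> and \<open>y\<close> of the identity
  as references. The traces are chosen as scalars since they dominate \<open>X\<close> and
  \<open>Y\<close>, which secures the kernel condition, and since their logarithms produce the
  entropy of mixing.\<close>

lemma neg_entropy_add_le:
  assumes "psd X" "psd Y"
  defines "x \<equiv> Re (trace X)" and "y \<equiv> Re (trace Y)"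
  shows "neg_entropy (X + Y) \<le> neg_entropy X + neg_entropy Y + ((x + y) * ln (x + y) - x * ln x - y * ln y)"
proof -
  have scalar: "psd (mscale (of_real c) (mat 1))" if "c \<ge> 0" for c
    unfolding conj_diag_const[OF unitary_mat_1] by (intro psd_conj_diag that)
  have "mscale (of_real (x + y)) (mat 1) = mscale (of_real x) (mat 1) + mscale (of_real y) (mat 1 :: 'a cmat)"
    by (simp add: vec_eq_iff mscale_def algebra_simps)
  then have "rel_entropy (X + Y) (mscale (of_real (x + y)) (mat 1)) \<le>
      rel_entropy X (mscale (of_real x) (mat 1)) + rel_entropy Y (mscale (of_real y) (mat 1))"
    using assms
    by (auto intro!: rel_entropy_joint_convex scalar ker_le_psd_diff psd_le_trace trace_psd)
  then show ?thesis
    unfolding rel_entropy_scalar by (simp add: trace_add_Re x_def y_def)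
qed

subsection \<open>Conditional entropy\<close>

text \<open>The form of the new matrix at \<open>v\<close> is that of \<open>X\<close> at the vector
  that moves coordinate \<open>i\<close> to \<open>f i\<close>, adding coordinates with equal image.
  This covers diagonal blocks and the summands of partial traces.\<close>

lemma psd_compress:
  fixes f :: "'m::finite \<Rightarrow> 'n::finite"
  assumes "psd X"
  shows "psd (\<chi> i j. X $ f i $ f j)"
  unfolding psd_def
proof
  fix v :: "complex ^ 'm"
  define w where "w = (\<Sum>i\<in>UNIV. v $ i *s axis (f i) 1)"
  have "cinner w (X *v w) = (\<Sum>i\<in>UNIV. \<Sum>j\<in>UNIV. cnj (v $ i) * X $ f i $ f j * v $ j)"
    by (simp add: w_def cinner_sum_left cinner_sum_right matrix_vector_mult_sum cinner_scale_left
        cinner_scale_right matrix_vector_scale cinner_axis sum_distrib_left mult_ac) (rule sum.swap)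
  then show "cinner v ((\<chi> i j. X $ f i $ f j) *v v) \<in> \<real>\<^sub>\<ge>\<^sub>0"
    using assms[unfolded psd_def, rule_format, of w] by (simp add: cinner_mult_expand[of v])
qed

lemma psd_sum: "(\<And>a. a \<in> A \<Longrightarrow> psd (F a)) \<Longrightarrow> psd (sum F A)"
  by (induction A rule: infinite_finite_induct) (simp_all add: psd_zero psd_add)

lemma psd_ptrace: "psd X \<Longrightarrow> psd (ptrace X)"
  unfolding ptrace_blocks block_def by (intro psd_sum psd_compress)

lemma psd_reduce_AB: "psd X \<Longrightarrow> psd (reduce_AB X)"
proof -
  assume "psd X"
  then have "psd (\<Sum>c\<in>UNIV. \<chi> p q. X $ (fst p, snd p, c) $ (fst q, snd q, c))"
    by (intro psd_sum psd_compress)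
  also have "(\<Sum>c\<in>UNIV. \<chi> p q. X $ (fst p, snd p, c) $ (fst q, snd q, c)) = reduce_AB X"
    by (simp add: vec_eq_iff reduce_AB_def)
  finally show ?thesis .
qed

lemma ptrace_add: "ptrace (X + Y) = ptrace X + ptrace Y"
  by (simp add: vec_eq_iff ptrace_def sum.distrib)

lemma tensor_1_add: "tensor (mat 1) (X + Y) = tensor (mat 1) X + tensor (mat 1) Y"
  by (simp add: vec_eq_iff tensor_def algebra_simps)

lemma tensor_1_nth: "tensor (mat 1) X $ p $ q = (if fst p = fst q then X $ snd p $ snd q else 0)"
  by (simp add: tensor_def mat_def)

lemma block_tensor_1: "block a a' (tensor (mat 1) X) = (if a = a' then X else 0)"
  by (simp add: vec_eq_iff block_def tensor_1_nth)

lemma cinner_tensor_1: "cinner v (tensor (mat 1) X *v w) = (\<Sum>a\<in>UNIV. cinner (slice a v) (X *v slice a w))"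
proof -
  have "(\<Sum>a'\<in>UNIV. cinner (slice a v) (block a a' (tensor (mat 1) X) *v slice a' w)) =
      (\<Sum>a'\<in>UNIV. if a = a' then cinner (slice a v) (X *v slice a' w) else 0)" for a
    by (intro sum.cong) (auto simp: block_tensor_1)
  then show ?thesis
    by (simp add: cinner_blocks)
qed

lemma psd_tensor_1: "psd X \<Longrightarrow> psd (tensor (mat 1) X)"
  by (simp add: psd_iff cinner_tensor_1 sum_nonneg)

lemma tensor_1_mult:
  "tensor (mat 1) X ** tensor (mat 1) Y = (tensor (mat 1) (X ** Y) :: ('a::finite \<times> 'b::finite) cmat)"
proof -
  have "(tensor (mat 1) X ** tensor (mat 1) Y) $ p $ q = tensor (mat 1) (X ** Y) $ p $ q" for p q :: "'a \<times> 'b"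
  proof -
    have "(tensor (mat 1) X ** tensor (mat 1) Y) $ p $ q =
        (\<Sum>a\<in>UNIV. \<Sum>i\<in>UNIV. tensor (mat 1) X $ p $ (a, i) * tensor (mat 1) Y $ (a, i) $ q)"
      by (simp add: matrix_matrix_mult_def sum_pairs)
    also have "\<dots> = (\<Sum>a\<in>UNIV. if fst p = a then
        (if a = fst q then \<Sum>i\<in>UNIV. X $ snd p $ i * Y $ i $ snd q else 0) else 0)"
      by (intro sum.cong) (auto simp: tensor_1_nth)
    also have "\<dots> = tensor (mat 1) (X ** Y) $ p $ q"
      by (simp add: tensor_1_nth matrix_matrix_mult_def)
    finally show ?thesis .
  qed
  then show ?thesis by (simp add: vec_eq_iff)
qed

lemma dagger_tensor_1: "dagger (tensor (mat 1) X) = tensor (mat 1) (dagger X)"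
  by (simp add: vec_eq_iff tensor_1_nth)

lemma trace_mult_tensor_1: "trace (X ** tensor (mat 1) Y) = trace (ptrace X ** Y)"
proof -
  have row: "(\<Sum>a'\<in>UNIV. \<Sum>j\<in>UNIV. X $ (a, i) $ (a', j) * tensor (mat 1) Y $ (a', j) $ (a, i)) =
      (\<Sum>a'\<in>UNIV. if a = a' then \<Sum>j\<in>UNIV. X $ (a, i) $ (a', j) * Y $ j $ i else 0)" for a i
    by (intro sum.cong) (auto simp: tensor_1_nth)
  have "trace (X ** tensor (mat 1) Y) = (\<Sum>a\<in>UNIV. \<Sum>i\<in>UNIV. \<Sum>a'\<in>UNIV. \<Sum>j\<in>UNIV.
      X $ (a, i) $ (a', j) * tensor (mat 1) Y $ (a', j) $ (a, i))"
    unfolding trace_def matrix_matrix_mult_def by (simp add: sum_pairs)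
  also have "\<dots> = (\<Sum>i\<in>UNIV. \<Sum>a\<in>UNIV. \<Sum>j\<in>UNIV. X $ (a, i) $ (a, j) * Y $ j $ i)"
    unfolding row by simp (rule sum.swap)
  also have "\<dots> = (\<Sum>i\<in>UNIV. \<Sum>j\<in>UNIV. \<Sum>a\<in>UNIV. X $ (a, i) $ (a, j) * Y $ j $ i)"
    by (intro sum.cong refl sum.swap)
  also have "\<dots> = trace (ptrace X ** Y)"
    unfolding trace_def matrix_matrix_mult_def by (simp add: ptrace_def sum_distrib_right)
  finally show ?thesis .
qed

text \<open>If \<open>U\<close> diagonalises \<open>Y\<close>, then \<open>tensor (mat 1) U\<close>
  diagonalises the ampliation, with eigenvalues \<open>d \<circ> snd\<close>.\<close>

lemma hfun_tensor_1:
  assumes "psd Y"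
  shows "hfun f (tensor (mat 1) Y) = (tensor (mat 1) (hfun f Y) :: ('a::finite \<times> 'b::finite) cmat)"
proof -
  obtain U d where U: "unitary U" and Y: "Y = U ** diag d ** dagger U"
    using psd_spectral[OF assms] by blast
  have diag: "tensor (mat 1) (diag e) = (diag (e \<circ> snd) :: ('a \<times> 'b) cmat)" for e :: "'b \<Rightarrow> real"
    by (auto simp: vec_eq_iff tensor_1_nth diag_def prod_eq_iff)
  have "tensor (mat 1) (mat 1) = (mat 1 :: ('a \<times> 'b) cmat)"
    by (simp add: vec_eq_iff tensor_1_nth) (simp add: mat_def)
  then have "unitary (tensor (mat 1) U :: ('a \<times> 'b) cmat)"
    by (simp add: unitary_def dagger_tensor_1 tensor_1_mult unitaryD[OF U])
  then show ?thesis
    unfolding Y hfun_eq[OF U] tensor_1_mult[symmetric] dagger_tensor_1[symmetric] diag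
    by (simp add: hfun_eq o_assoc)
qed

text \<open>Minus the conditional entropy of the first factor given the second, in natural units.
  Written as a relative entropy it inherits joint convexity and data processing.\<close>

definition neg_cond_entropy :: "('a::finite \<times> 'b::finite) cmat \<Rightarrow> real" where
  "neg_cond_entropy X = rel_entropy X (tensor (mat 1) (ptrace X))"

lemma neg_cond_entropy_eq:
  assumes "psd X"
  shows "neg_cond_entropy X = neg_entropy X - neg_entropy (ptrace X)"
  unfolding neg_cond_entropy_def rel_entropy_def hfun_tensor_1[OF psd_ptrace[OF assms]]
    trace_mult_tensor_1 neg_entropy_def ..

section \<open>Pinching and the dimension bound\<close>

lemma psd_form_sum_le:
  fixes x :: "'a::finite \<Rightarrow> complex ^ 'n::finite"
  assumes "psd X"
  shows "Re (cinner (sum x UNIV) (X *v sum x UNIV)) \<le> CARD('a) * (\<Sum>a\<in>UNIV. Re (cinner (x a) (X *v x a)))"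
proof -
  define B where "B a b = Re (cinner (x a) (X *v x b))" for a b
  \<comment> \<open>Convexity of the form: its values at all differences \<open>x a - x b\<close>
    are nonnegative, and expanding their sum leaves the claim.\<close>
  have "0 \<le> (\<Sum>a\<in>UNIV. \<Sum>b\<in>UNIV. Re (cinner (x a - x b) (X *v (x a - x b))))"
    using assms by (intro sum_nonneg) (simp add: psd_iff)
  also have "\<dots> = (\<Sum>a\<in>UNIV. \<Sum>b\<in>UNIV. B a a + B b b - B a b - B b a)"
    by (simp add: B_def cinner_diff_left cinner_diff_right matrix_vector_mult_diff_distrib algebra_simps)
  also have "\<dots> = 2 * CARD('a) * (\<Sum>a\<in>UNIV. B a a) - (\<Sum>a\<in>UNIV. \<Sum>b\<in>UNIV. B a b) - (\<Sum>a\<in>UNIV. \<Sum>b\<in>UNIV. B b a)"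
    by (simp add: sum.distrib sum_subtractf sum_distrib_left mult.assoc)
  finally have "0 \<le> 2 * CARD('a) * (\<Sum>a\<in>UNIV. B a a) - (\<Sum>a\<in>UNIV. \<Sum>b\<in>UNIV. B a b) -
      (\<Sum>a\<in>UNIV. \<Sum>b\<in>UNIV. B b a)" .
  moreover have "(\<Sum>a\<in>UNIV. \<Sum>b\<in>UNIV. B a b) = (\<Sum>a\<in>UNIV. \<Sum>b\<in>UNIV. B b a)"
    by (rule sum.swap)
  moreover have "(\<Sum>a\<in>UNIV. \<Sum>b\<in>UNIV. B b a) = Re (cinner (sum x UNIV) (X *v sum x UNIV))"
    by (simp add: B_def cinner_sum_left cinner_sum_right matrix_vector_mult_sum)
  ultimately show ?thesis
    by (simp add: B_def)
qed

definition embed :: "'a::finite \<Rightarrow> complex ^ 'b::finite \<Rightarrow> complex ^ ('a \<times> 'b)" where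
  "embed a u = (\<chi> p. if fst p = a then u $ snd p else 0)"

lemma slice_embed: "slice b (embed a u) = (if a = b then u else 0)"
  by (auto simp: vec_eq_iff slice_def embed_def)

lemma cinner_embed: "cinner (embed a u) (X *v embed a w) = cinner u (block a a X *v w)"
proof -
  have "(\<Sum>b'\<in>UNIV. cinner (slice b (embed a u)) (block b b' X *v slice b' (embed a w))) =
      (\<Sum>b'\<in>UNIV. if a = b' then (if a = b then cinner u (block b b' X *v w) else 0) else 0)" for b
    by (intro sum.cong) (auto simp: slice_embed)
  then show ?thesis
    by (simp add: cinner_blocks[of "embed a u"])
qed

text \<open>Split \<open>v\<close> into its slices. Convexity of the form costs the factor
  \<open>CARD('a)\<close> and leaves the diagonal blocks of \<open>X\<close>, each of which is at
  most their sum \<open>ptrace X\<close>.\<close>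

lemma pinching:
  fixes X :: "('a::finite \<times> 'b::finite) cmat"
  assumes "psd X"
  shows "psd (mscale (of_real (real CARD('a))) (tensor (mat 1) (ptrace X)) - X)"
  unfolding psd_iff
proof (intro allI conjI)
  fix v :: "complex ^ ('a \<times> 'b)"
  define T where "T = (tensor (mat 1) (ptrace X) :: ('a \<times> 'b) cmat)"
  have "psd T"
    unfolding T_def by (intro psd_tensor_1 psd_ptrace assms)
  have form: "cinner v ((mscale (of_real (real CARD('a))) T - X) *v v) =
      of_real (real CARD('a)) * cinner v (T *v v) - cinner v (X *v v)"
    by (simp add: matrix_vector_mult_diff_rdistrib cinner_diff_right mscale_vector cinner_scale_right)
  show "Im (cinner v ((mscale (of_real (real CARD('a))) (tensor (mat 1) (ptrace X)) - X) *v v)) = 0"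
    unfolding T_def[symmetric] form using \<open>psd T\<close> \<open>psd X\<close> by (simp add: psd_iff)
  define x where "x a = embed a (slice a v)" for a
  have v: "v = sum x UNIV"
    by (simp add: vec_eq_iff x_def embed_def slice_def)
  have "Re (cinner v (X *v v)) \<le> CARD('a) * (\<Sum>a\<in>UNIV. Re (cinner (x a) (X *v x a)))"
    unfolding v by (rule psd_form_sum_le[OF assms])
  also have "(\<Sum>a\<in>UNIV. Re (cinner (x a) (X *v x a))) = (\<Sum>a\<in>UNIV. Re (cinner (slice a v) (block a a X *v slice a v)))"
    by (simp add: x_def cinner_embed)
  also have "\<dots> \<le> (\<Sum>a\<in>UNIV. \<Sum>b\<in>UNIV. Re (cinner (slice a v) (block b b X *v slice a v)))"
  proof (intro sum_mono member_le_sum)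
    show "0 \<le> Re (cinner (slice a v) (block b b X *v slice a v))" for a b
      using assms by (simp add: psd_iff cinner_embed[symmetric])
  qed auto
  also have "\<dots> = Re (cinner v (T *v v))"
  proof -
    have sum_mult: "sum f A *v u = (\<Sum>b\<in>A. f b *v u)" for f :: "'a \<Rightarrow> 'b cmat" and A u
      by (induction A rule: infinite_finite_induct) (simp_all add: matrix_vector_mult_add_rdistrib)
    show ?thesis
      by (simp add: T_def cinner_tensor_1 ptrace_blocks sum_mult cinner_sum_right)
  qed
  finally show "0 \<le> Re (cinner v ((mscale (of_real (real CARD('a))) (tensor (mat 1) (ptrace X)) - X) *v v))"
    unfolding T_def[symmetric] form by (simp add: mult_left_mono)
qed

lemma ker_le_ptrace:
  fixes X :: "('a::finite \<times> 'b::finite) cmat"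
  assumes "psd X"
  shows "ker_le (tensor (mat 1) (ptrace X)) X"
proof -
  have "ker_le (mscale (of_real (real CARD('a))) (tensor (mat 1) (ptrace X))) X"
    by (rule ker_le_psd_diff[OF assms pinching[OF assms]])
  then show ?thesis
    by (simp add: ker_le_def mscale_vector cinner_scale_right)
qed

text \<open>The upper bound is the pinching order relation with reference \<open>d\<close> times
  \<open>T\<close>. The lower bound is Klein's inequality with reference \<open>T\<close> divided by
  \<open>d\<close>, whose trace equals that of \<open>X\<close>. Rescaling the reference produces
  the terms with \<open>ln d\<close>.\<close>

lemma neg_cond_entropy_bounds:
  fixes X :: "('a::finite \<times> 'b::finite) cmat"
  assumes "psd X"
  shows "neg_cond_entropy X \<le> Re (trace X) * ln CARD('a)"
    and "- (Re (trace X) * ln CARD('a)) \<le> neg_cond_entropy X"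
proof -
  define d where "d = real CARD('a)"
  define T where "T = (tensor (mat 1) (ptrace X) :: ('a \<times> 'b) cmat)"
  have d: "d > 0" by (simp add: d_def)
  have T: "psd T" "ker_le T X"
    using psd_tensor_1[OF psd_ptrace[OF assms]] ker_le_ptrace[OF assms] by (simp_all add: T_def)
  have "rel_entropy X (mscale (of_real d) T) \<le> 0"
    unfolding d_def T_def by (intro rel_entropy_le_0 assms pinching)
  then show "neg_cond_entropy X \<le> Re (trace X) * ln CARD('a)"
    using rel_entropy_mscale[OF assms T d] by (simp add: neg_cond_entropy_def T_def d_def)
  have "trace T = of_real d * trace X"
    by (simp add: T_def d_def trace_blocks[of "tensor _ _"] block_tensor_1 trace_ptrace)
  then have "Re (trace (mscale (of_real (1 / d)) T)) = Re (trace X)"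
    using d by (simp add: trace_mscale)
  moreover have "psd (mscale (of_real (1 / d)) T)" "ker_le (mscale (of_real (1 / d)) T) X"
    using T d by (auto simp: psd_iff ker_le_def mscale_vector cinner_scale_right)
  ultimately have "0 \<le> rel_entropy X (mscale (of_real (1 / d)) T)"
    using rel_entropy_ge[OF assms, of "mscale (of_real (1 / d)) T"] by simp
  then show "- (Re (trace X) * ln CARD('a)) \<le> neg_cond_entropy X"
    using rel_entropy_mscale[OF assms T, of "1 / d"] d
    by (simp add: neg_cond_entropy_def T_def ln_div flip: d_def)
qed

lemma neg_cond_entropy_add:
  assumes "psd X" "psd Y"
  shows "neg_cond_entropy (X + Y) \<le> neg_cond_entropy X + neg_cond_entropy Y"
  unfolding neg_cond_entropy_def ptrace_add tensor_1_add
  by (intro rel_entropy_joint_convex psd_tensor_1 psd_ptrace ker_le_ptrace assms)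

text \<open>The negative conditional entropy of the common operator \<open>X + M = Y + N\<close> is
  estimated twice: from below through \<open>X\<close> and \<open>M\<close>, where the marginals
  cost the mixing term, and from above through \<open>Y\<close> and \<open>N\<close>. The parts
  \<open>M\<close> and \<open>N\<close> cost \<open>T * ln CARD('a)\<close> each.\<close>

lemma neg_cond_entropy_continuity:
  fixes X Y M N :: "('a::finite \<times> 'b::finite) cmat"
  assumes psd: "psd X" "psd Y" "psd M" "psd N"
    and eq: "X + M = Y + N"
    and tr: "trace X = 1" "Re (trace M) = T" "Re (trace N) = T"
  shows "neg_cond_entropy X - neg_cond_entropy Y \<le>
    2 * T * ln CARD('a) + (1 + T) * ln (1 + T) - T * ln T"
proof -
  have "neg_cond_entropy (X + M) = neg_entropy (X + M) - neg_entropy (ptrace X + ptrace M)"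
    using neg_cond_entropy_eq[OF psd_add[OF psd(1,3)]] by (simp add: ptrace_add)
  moreover have "neg_entropy X + neg_entropy M \<le> neg_entropy (X + M)"
    by (intro neg_entropy_add_ge psd)
  moreover have "neg_entropy (ptrace X + ptrace M) \<le> neg_entropy (ptrace X) + neg_entropy (ptrace M) +
      ((1 + T) * ln (1 + T) - T * ln T)"
    using neg_entropy_add_le[OF psd_ptrace[OF psd(1)] psd_ptrace[OF psd(3)]] tr by (simp add: trace_ptrace)
  moreover have "neg_cond_entropy (Y + N) \<le> neg_cond_entropy Y + neg_cond_entropy N"
    by (intro neg_cond_entropy_add psd)
  moreover have "neg_cond_entropy N \<le> T * ln CARD('a)" "- (T * ln CARD('a)) \<le> neg_cond_entropy M"
    using neg_cond_entropy_bounds[OF psd(4)] neg_cond_entropy_bounds[OF psd(3)] tr by simp_all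
  ultimately show ?thesis
    using neg_cond_entropy_eq[OF psd(1)] neg_cond_entropy_eq[OF psd(3)] eq by simp
qed

section \<open>Jordan decomposition and the trace norm\<close>

lemma jordan_decomposition:
  fixes X :: "'n::finite cmat"
  assumes "dagger X = X"
  obtains P N where "psd P" "psd N" "X = P - N" "trace_norm X = Re (trace P) + Re (trace N)"
proof -
  obtain U d where U: "unitary U" and X: "X = U ** diag d ** dagger U"
    using spectral[OF assms] by blast
  define P N where "P = U ** diag (\<lambda>i. max (d i) 0) ** dagger U"
    and "N = U ** diag (\<lambda>i. max (- d i) 0) ** dagger U"
  have "sqrt \<circ> (\<lambda>i. d i * d i) = (\<lambda>i. \<bar>d i\<bar>)"
    by auto
  then have "trace_norm X = (\<Sum>i\<in>UNIV. \<bar>d i\<bar>)"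
    unfolding trace_norm_def assms unfolding X conj_diag_mult[OF U] hfun_eq[OF U]
    by (simp add: trace_conj_diag[OF U])
  also have "\<dots> = Re (trace P) + Re (trace N)"
    unfolding P_def N_def trace_conj_diag[OF U] Re_complex_of_real sum.distrib[symmetric]
    by (intro sum.cong) auto
  finally have "trace_norm X = Re (trace P) + Re (trace N)" .
  moreover have "psd P" "psd N"
    unfolding P_def N_def by (auto intro!: psd_conj_diag)
  moreover have "X = P - N"
    unfolding P_def N_def conj_diag_diff X by (intro arg_cong[of _ _ "\<lambda>e. U ** diag e ** dagger U"]) auto
  ultimately show thesis using that by blast
qed

subsection \<open>The bound\<close>

text \<open>This weakens the continuity bound to the claimed form. \<open>S = e / 2\<close> is the
  largest admissible \<open>T\<close>; the terms in \<open>T\<close> are majorised at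
  \<open>S\<close>, and then multiples of \<open>S\<close>, \<open>S * ln 2\<close> and
  \<open>S * ln S\<close> are compared using \<open>2 / 3 \<le> ln 2 \<le> L\<close>.\<close>

lemma binary_entropy_estimate:
  fixes T e L :: real
  assumes "0 \<le> T" "2 * T \<le> e" "e \<le> 1 / 2" "ln 2 \<le> L"
  shows "2 * T * L + (1 + T) * ln (1 + T) - T * ln T \<le>
    4 * e * L + 2 * (- (2 * e) * ln (2 * e) - (1 - 2 * e) * ln (1 - 2 * e))"
proof (cases "e = 0")
  case True
  then show ?thesis using assms by simp
next
  case False
  define S where "S = e / 2"
  have S: "0 < S" "T \<le> S" "S \<le> 1 / 4" "e = 2 * S"
    using assms False by (auto simp: S_def)
  have ln2: "ln 2 \<ge> (2 / 3 :: real)"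
    by (rule ln2_ge_two_thirds)
  have ln4: "ln 4 = 2 * ln (2 :: real)" and ln8: "ln 8 = 3 * ln (2 :: real)"
    using ln_realpow[of 2 2] ln_realpow[of 2 3] by simp_all
  have "(1 + T) * ln (1 + T) \<le> (1 + T) * T"
    using assms ln_add_one_self_le_self[of T] by (intro mult_left_mono) auto
  also have "\<dots> \<le> (5 / 4) * S"
    using assms S by (intro mult_mono) auto
  finally have A: "(1 + T) * ln (1 + T) \<le> 5 / 4 * S" .
  \<comment> \<open>\<open>- x * ln x\<close> increases up to \<open>exp (-1)\<close>, and
    \<open>S \<le> 1 / 4\<close> lies below that point. The bound \<open>ln x \<le> x - 1\<close> at
    \<open>x = S / T\<close> replaces differentiation.\<close>
  have B: "- T * ln T \<le> - S * ln S"
  proof (cases "T = 0")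
    case True
    then show ?thesis using S by (simp add: mult_le_0_iff)
  next
    case False
    then have T: "T > 0" using assms by simp
    have "ln (S / T) \<le> S / T - 1"
      using S T by (intro ln_le_minus_one) simp
    then have "T * (ln S - ln T) \<le> T * (S / T - 1)"
      using S T by (intro mult_left_mono) (simp_all add: ln_div)
    also have "\<dots> = S - T"
      using T by (simp add: algebra_simps)
    finally have "- T * ln T \<le> (S - T) - T * ln S"
      by (simp add: algebra_simps)
    moreover have "ln S \<le> ln (1 / 4)"
      using S by (intro ln_mono) auto
    then have "ln S \<le> -1"
      using ln2 ln4 by (simp add: ln_div)
    then have "(S - T) * (ln S + 1) \<le> 0"
      using S by (intro mult_nonneg_nonpos) auto
    ultimately show ?thesis
      by (simp add: algebra_simps)
  qed
  have C: "(1 - 2 * e) * ln (1 - 2 * e) \<le> 0"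
  proof (cases "2 * e = 1")
    case False
    then show ?thesis
      using assms S by (intro mult_nonneg_nonpos) auto
  qed simp
  have D: "2 * T * L \<le> 2 * S * L"
    using S assms ln2 by (intro mult_right_mono) auto
  have LS: "S * ln 2 \<le> S * L"
    using S assms by (intro mult_left_mono) auto
  have S2: "S * (2 / 3) \<le> S * ln 2"
    using S ln2 by (intro mult_left_mono) auto
  \<comment> \<open>Of \<open>4 * e * L\<close>, which is 8 times \<open>S * L\<close>, two units
    cover \<open>2 * T * L\<close> and six remain. For \<open>e \<le> 1 / 4\<close> the binary
    entropy term outweighs \<open>- S * ln S\<close>; for larger \<open>e\<close> one has
    \<open>- S * ln S \<le> 3 * S * ln 2\<close>, and the six units alone suffice.\<close>
  consider "e \<le> 1 / 4" | "e \<ge> 1 / 4" by linarith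
  then have "5 / 4 * S - S * ln S \<le> 6 * (S * L) - 2 * (2 * e) * ln (2 * e)"
  proof cases
    case 1
    have "ln (4 * S) \<le> ln (1 / 2)"
      using 1 S by (intro ln_mono) auto
    then have "ln (4 * S) \<le> - ln 2"
      by (simp add: ln_div)
    moreover have "ln (4 * S) = 2 * ln 2 + ln S"
      using S by (simp add: ln_mult_pos ln4)
    ultimately have "ln S \<le> - 3 * ln 2" and e: "2 * (2 * e) * ln (2 * e) = 8 * S * (2 * ln 2 + ln S)"
      using S by auto
    then have "S * ln S \<le> S * (- 3 * ln 2)"
      using S by (intro mult_left_mono) auto
    moreover have "S * (- 3 * ln 2) = - 3 * (S * ln 2)"
      by simp
    moreover have "8 * S * (2 * ln 2 + ln S) = 16 * (S * ln 2) + 8 * (S * ln S)"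
      by (simp add: algebra_simps)
    ultimately show ?thesis
      unfolding e using S2 LS S(1) by linarith
  next
    case 2
    have "ln (1 / 8) \<le> ln S"
      using 2 S by (intro ln_mono) auto
    then have "S * (- 3 * ln 2) \<le> S * ln S"
      using S by (intro mult_left_mono) (simp_all add: ln_div ln8)
    moreover have "S * (- 3 * ln 2) = - 3 * (S * ln 2)"
      by simp
    moreover have "2 * (2 * e) * ln (2 * e) \<le> 0"
      using 2 assms by (intro mult_nonneg_nonpos) auto
    ultimately show ?thesis
      using S2 LS S(1) by linarith
  qed
  then show ?thesis
    using A B C D S by (simp add: algebra_simps)
qed

theorem lemma1:
  fixes \<sigma> :: "('a::finite \<times> 'b::finite) cmat"
    and \<Phi> :: "'b cmat \<Rightarrow> ('b \<times> 'c::finite) cmat"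
    and \<rho> :: "('a \<times> 'b \<times> 'c) cmat"
    and k \<epsilon> :: real
  assumes "k > 1"
    and "density_matrix \<sigma>"
    and "cptp \<Phi>"
    and "\<rho> = id_tensor \<Phi> \<sigma>"
    and "trace_norm (\<sigma> - reduce_AB \<rho>) \<le> \<epsilon>"
    and "\<epsilon> \<le> 1 / 2"
  shows "cond_mutual_info k \<rho> \<le> 4 * \<epsilon> * log k (real CARD('a)) + 2 * binary_entropy k (2 * \<epsilon>)"
proof -
  define \<tau> where "\<tau> = reduce_AB \<rho>"
  have \<sigma>: "psd \<sigma>" "trace \<sigma> = 1"
    using \<open>density_matrix \<sigma>\<close> by (auto simp: density_matrix_def)
  have lin: "Vector_Spaces.linear mscale mscale \<Phi>"
    using \<open>cptp \<Phi>\<close> by (simp add: cptp_def)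
  have chan: "cptp (id_tensor \<Phi> :: ('a \<times> 'b) cmat \<Rightarrow> ('a \<times> 'b \<times> 'c) cmat)"
    by (rule cptp_id_tensor[OF \<open>cptp \<Phi>\<close>])
  have \<rho>: "psd \<rho>" "trace \<rho> = 1"
    using cptp_psd[OF chan \<sigma>(1)] chan \<sigma> by (simp_all add: assms(4) cptp_def)
  have \<tau>: "psd \<tau>"
    unfolding \<tau>_def by (rule psd_reduce_AB[OF \<rho>(1)])
  have tr_\<tau>: "trace \<tau> = 1"
  proof -
    have "trace \<tau> = trace \<rho>"
      unfolding trace_def \<tau>_def reduce_AB_def by (simp add: sum_pairs)
    then show ?thesis by (simp add: \<rho>)
  qed
  have BC: "reduce_BC \<rho> = ptrace \<rho>"
    by (simp add: vec_eq_iff reduce_BC_def ptrace_def)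
  have B: "reduce_B \<rho> = ptrace \<tau>"
    by (simp add: vec_eq_iff reduce_B_def ptrace_def \<tau>_def reduce_AB_def)
  have "neg_cond_entropy \<rho> \<le> neg_cond_entropy \<sigma>"
  proof -
    have *: "id_tensor \<Phi> (tensor (mat 1) (ptrace \<sigma>)) = tensor (mat 1) (ptrace \<rho>)"
      by (simp add: id_tensor_tensor[OF lin] ptrace_id_tensor[OF lin] assms(4))
    have "rel_entropy (id_tensor \<Phi> \<sigma>) (id_tensor \<Phi> (tensor (mat 1) (ptrace \<sigma>))) \<le>
        rel_entropy \<sigma> (tensor (mat 1) (ptrace \<sigma>))"
      using ker_le_ptrace[OF \<rho>(1)]
      by (intro data_processing chan psd_tensor_1 psd_ptrace \<sigma> ker_le_ptrace)
        (simp add: * flip: assms(4))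
    then show ?thesis
      by (simp add: neg_cond_entropy_def * flip: assms(4))
  qed
  moreover have "cond_mutual_info k \<rho> = (neg_cond_entropy \<rho> - neg_cond_entropy \<tau>) / ln k"
    unfolding cond_mutual_info_def BC B \<tau>_def[symmetric] neg_cond_entropy_eq[OF \<rho>(1)] neg_cond_entropy_eq[OF \<tau>]
    by (simp add: entropy_neg_entropy \<tau> \<rho> psd_ptrace diff_divide_distrib add_divide_distrib)
  moreover have lnk: "ln k > 0"
    using \<open>k > 1\<close> by simp
  ultimately have le: "cond_mutual_info k \<rho> \<le> (neg_cond_entropy \<sigma> - neg_cond_entropy \<tau>) / ln k"
    by (simp add: divide_right_mono)
  define h where "h = - (2 * \<epsilon>) * ln (2 * \<epsilon>) - (1 - 2 * \<epsilon>) * ln (1 - 2 * \<epsilon>)"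
  define L where "L = ln (real CARD('a))"
  have "dagger (\<sigma> - \<tau>) = \<sigma> - \<tau>"
    using psd_hermitian[OF \<sigma>(1)] psd_hermitian[OF \<tau>] by (simp add: vec_eq_iff)
  then obtain N M where NM: "psd N" "psd M" "\<sigma> - \<tau> = N - M"
    and norm: "trace_norm (\<sigma> - \<tau>) = Re (trace N) + Re (trace M)"
    using jordan_decomposition by blast
  define T where "T = Re (trace M)"
  have "trace (\<sigma> - \<tau>) = 0"
    by (simp add: trace_sub \<sigma> tr_\<tau>)
  then have T_N: "Re (trace N) = T"
    by (simp add: NM(3) trace_sub T_def)
  \<comment> \<open>The trace norm counts both Jordan parts, whose traces agree, so each is at most
    half of \<open>\<epsilon>\<close>.\<close>
  have T: "0 \<le> T" "2 * T \<le> \<epsilon>"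
    using trace_psd[OF NM(2)] norm T_N assms(5) by (simp_all add: T_def \<tau>_def)
  have "neg_cond_entropy \<sigma> - neg_cond_entropy \<tau> \<le> 4 * \<epsilon> * L + 2 * h"
  proof (cases "CARD('a) = 1")
    \<comment> \<open>Here \<open>L = 0\<close>, so the estimate requiring
      \<open>ln 2 \<le> L\<close> does not apply. Both conditional entropies vanish by the dimension
      bounds, and \<open>h \<ge> 0\<close> because \<open>T\<close> forces
      \<open>\<epsilon> \<ge> 0\<close>.\<close>
    case True
    have "neg_cond_entropy \<sigma> - neg_cond_entropy \<tau> \<le> 0"
      using neg_cond_entropy_bounds(1)[OF \<sigma>(1)] neg_cond_entropy_bounds(2)[OF \<tau>] True by simp
    moreover have "x * ln x \<le> 0" if "0 \<le> x" "x \<le> 1" for x :: real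
      using that by (cases "x = 0") (auto intro!: mult_nonneg_nonpos)
    from this[of "2 * \<epsilon>"] this[of "1 - 2 * \<epsilon>"] have "h \<ge> 0"
      unfolding h_def using T assms(6) by simp
    ultimately show ?thesis
      using True by (simp add: L_def)
  next
    case False
    then have "CARD('a) \<ge> 2"
      using zero_less_card_finite[where 'a = 'a] by linarith
    then have "ln 2 \<le> L"
      unfolding L_def by (intro ln_mono) auto
    have "\<sigma> + M = \<tau> + N"
      using NM(3) by (simp add: algebra_simps)
    then have "neg_cond_entropy \<sigma> - neg_cond_entropy \<tau> \<le> 2 * T * L + (1 + T) * ln (1 + T) - T * ln T"
      unfolding L_def using T_N
      by (intro neg_cond_entropy_continuity[of \<sigma> \<tau> M N] \<sigma> \<tau> NM) (simp_all add: T_def)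
    also have "\<dots> \<le> 4 * \<epsilon> * L + 2 * h"
      unfolding h_def by (rule binary_entropy_estimate[OF T assms(6) \<open>ln 2 \<le> L\<close>])
    finally show ?thesis .
  qed
  then have "(neg_cond_entropy \<sigma> - neg_cond_entropy \<tau>) / ln k \<le> (4 * \<epsilon> * L + 2 * h) / ln k"
    using lnk by (simp add: divide_right_mono)
  also have "\<dots> = 4 * \<epsilon> * log k (real CARD('a)) + 2 * binary_entropy k (2 * \<epsilon>)"
    by (simp add: L_def h_def binary_entropy_def log_def add_divide_distrib diff_divide_distrib)
  finally show ?thesis
    using le by linarith
qed

end
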